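(* Let $\Phi=\{x_i\}$ be a homogeneous Poisson point process on $\mathbb{R}^2$ with intensity $\lambda>0$, let $x\in\mathbb{R}^2$ be a receiver, let $\alpha>2$ and let $0<\phi\le 2\pi$ be the reception angle. Each point $x_i$ carries a channel gain $h_i\ge 0$; the $h_i$ are i.i.d. with PDF $f_h$, independent of $\Phi$, and $\bar h_{2/\alpha}:=E_h[h^{2/\alpha}]=\int_0^\infty h^{2/\alpha}f_h(h)\,dh<\infty$. Let $\Phi'=\{x_i\in\Phi:\ \angle\overrightarrow{x x_i}\le\phi\}$, where $\angle\overrightarrow{x x_i}\in[0,2\pi)$ is the angle of the vector $x_i-x$ with respect to the horizontal axis. For $x_i\in\Phi'$ put $I_i=h_i\|x-x_i\|^{-\alpha}$ and $z_i=I_i^{-1}=\|x_i-x\|^{\alpha}/h_i$, and order these values increasingly as $z_1<z_2<\cdots$, so that $I_n=z_n^{-1}$ is the $n$-th largest (the $n$-th dominant) interference power. Then for every $n\ge 1$, $z_n$ has probability density function $$f^{\phi}_{z_n}(z)=\frac{2\exp\left\{-\tfrac12\bar h_{2/\alpha}\phi\lambda z^{2/\alpha}\right\}\left(\tfrac12\bar h_{2/\alpha}\phi\lambda z^{2/\alpha}\right)^n}{\alpha\, z\,(n-1)!},\qquad z>0.$$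
   Context: $\|\cdot\|$ is the Euclidean norm. *)

theory Defs
  imports "HOL-Analysis.Analysis" "HOL-Probability.Probability"
begin

definition vec_angle :: "real^2 \<Rightarrow> real" where
  "vec_angle v = (let a = Arg (Complex (v$1) (v$2)) in if a < 0 then a + 2 * pi else a)"

definition pcount :: "(nat \<Rightarrow> real^2) \<Rightarrow> (real^2) set \<Rightarrow> nat" where
  "pcount xs B = card {i. xs i \<in> B}"

text \<open>Homogeneous Poisson point process on the plane with intensity lam, given through an
  injective enumeration X w i of its points (the point process Phi(w) = range (X w)):
  locally finite realisations, Poisson counts with mean lam * area on bounded Borel sets,
  and independent counts on pairwise disjoint bounded Borel sets.\<close>
definition poisson_pp :: "'w measure \<Rightarrow> real \<Rightarrow> ('w \<Rightarrow> nat \<Rightarrow> real^2) \<Rightarrow> bool" where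
  "poisson_pp M lam X \<longleftrightarrow>
     prob_space M \<and>
     (\<forall>i. (\<lambda>w. X w i) \<in> borel_measurable M) \<and>
     (\<forall>w\<in>space M. inj (X w)) \<and>
     (\<forall>w\<in>space M. \<forall>B. bounded B \<longrightarrow> finite {i. X w i \<in> B}) \<and>
     (\<forall>B k. B \<in> sets lborel \<longrightarrow> bounded B \<longrightarrow>
        measure M {w \<in> space M. pcount (X w) B = k}
          = exp (- lam * measure lborel B) * (lam * measure lborel B) ^ k / fact k) \<and>
     (\<forall>(B :: nat \<Rightarrow> (real^2) set) m.
        (\<forall>j<m. B j \<in> sets lborel \<and> bounded (B j)) \<longrightarrow> disjoint_family_on B {..<m} \<longrightarrow>
        prob_space.indep_vars M (\<lambda>_. count_space UNIV) (\<lambda>j w. pcount (X w) (B j)) {..<m})"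

text \<open>Indices of points seen within the reception angle phi from the receiver x, with
  strictly positive channel gain (points with zero gain contribute zero interference,
  i.e. z_i = infinity, and never appear among the dominant interferers).\<close>
definition sector_idx :: "real^2 \<Rightarrow> real \<Rightarrow> (nat \<Rightarrow> real^2) \<Rightarrow> (nat \<Rightarrow> real) \<Rightarrow> nat set" where
  "sector_idx x phi xs hs = {i. vec_angle (xs i - x) \<le> phi \<and> hs i > 0}"

definition zval :: "real \<Rightarrow> real^2 \<Rightarrow> (nat \<Rightarrow> real^2) \<Rightarrow> (nat \<Rightarrow> real) \<Rightarrow> nat \<Rightarrow> real" where
  "zval alpha x xs hs i = norm (xs i - x) powr alpha / hs i"

definition nth_z :: "real \<Rightarrow> real \<Rightarrow> real^2 \<Rightarrow> (nat \<Rightarrow> real^2) \<Rightarrow> (nat \<Rightarrow> real) \<Rightarrow> nat \<Rightarrow> real" where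
  "nth_z alpha phi x xs hs n =
     Inf {t. n \<le> card {i \<in> sector_idx x phi xs hs. zval alpha x xs hs i \<le> t}}"

end

theory Submission
  imports Defs
begin

text \<open>
  For \<open>t \<ge> 0\<close> let \<open>N t\<close> be the set of points in the sector with \<open>z\<^sub>i \<le> t\<close>. Conditionally on the
  process, a point at \<open>y\<close> is in \<open>N t\<close> with a probability \<open>q(y)\<close>, independently of the others, so
  \<open>E[s ^ card (N t)] = E[\<Prod>\<^sub>i (1 - (1 - s) q(x\<^sub>i))] = exp (-(1 - s) \<lambda> \<integral>q)\<close> by the probability
  generating functional of the Poisson process. Comparing coefficients in \<open>s\<close>, \<open>card (N t)\<close> is Poisson
  with mean \<open>\<lambda> \<integral>q\<close>. By Fubini \<open>\<integral>q\<close> is the expected area of a sector of angle \<open>\<phi>\<close> and radius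
  \<open>(t h) powr (1 / \<alpha>)\<close>, that is \<open>\<phi> / 2 * t powr (2 / \<alpha>) * hbar\<close>. Finally \<open>z\<^sub>n > t\<close> holds almost
  surely iff \<open>card (N t) < n\<close>, and differentiating the probability of the latter gives the density.
\<close>

subsection \<open>Area of a circular sector\<close>

text \<open>Rotations cut the disc into \<open>m\<close> congruent wedges; monotonicity in the angle does the rest.\<close>

definition polar :: "real \<Rightarrow> real \<Rightarrow> real^2" where
  "polar r a = vector [r * cos a, r * sin a]"

definition rot :: "real \<Rightarrow> real^2 \<Rightarrow> real^2" where
  "rot c v = vector [cos c * v$1 - sin c * v$2, sin c * v$1 + cos c * v$2]"

text \<open>Half-open in the angle, so that neighbouring wedges tile without overlap. The origin is
  left out because rotations fix it while its \<open>vec_angle\<close> is 0, so it would not move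
  along with a wedge.\<close>

definition wedge :: "real \<Rightarrow> real \<Rightarrow> real \<Rightarrow> (real^2) set" where
  "wedge r a b = {v. v \<noteq> 0 \<and> norm v \<le> r \<and> a \<le> vec_angle v \<and> vec_angle v < b}"

lemma norm_vec2: "norm (v :: real^2) = cmod (Complex (v$1) (v$2))"
  by (simp add: norm_vec_def L2_set_def UNIV_2 complex_norm)

text \<open>\<open>Arg\<close> takes values in (-pi, pi], and adding a full turn to the negative
  ones leaves the exponential unchanged, so uniqueness of the argument in [0, 2 * pi) applies. At
  the origin both sides are 0.\<close>

lemma vec_angle_eq_Arg2pi: "vec_angle v = Arg2pi (Complex (v$1) (v$2))"
proof -
  define z where "z = Complex (v$1) (v$2)"
  show ?thesis
  proof (cases "z = 0")
    case True
    then show ?thesis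
      by (simp add: vec_angle_def z_def[symmetric] Arg_zero)
  next
    case False
    have z: "of_real (cmod z) * exp (\<i> * of_real (Arg z)) = z"
      using Arg_eq[OF False] by simp
    have "Arg2pi z = (if Arg z < 0 then Arg z + 2 * pi else Arg z)"
    proof (rule Arg2pi_unique[where r="cmod z"])
      have "exp (\<i> * of_real (Arg z + 2 * pi)) = exp (\<i> * of_real (Arg z))"
        by (simp add: distrib_left exp_add mult.commute)
      then show "of_real (cmod z) * exp (\<i> * of_real (if Arg z < 0 then Arg z + 2 * pi else Arg z)) = z"
        using z by simp
    qed (use False Arg_bounded[of z] pi_gt_zero in \<open>auto\<close>)
    then show ?thesis
      by (simp add: vec_angle_def z_def[symmetric] Let_def)
  qed
qed

lemma vec_angle_bounds: "0 \<le> vec_angle v" "vec_angle v < 2 * pi"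
  by (simp_all add: vec_angle_eq_Arg2pi Arg2pi_ge_0 Arg2pi_lt_2pi)

lemma polar_eta: "polar (norm v) (vec_angle v) = v"
  unfolding polar_def vec_angle_eq_Arg2pi norm_vec2
  by (simp add: cos_Arg2pi sin_Arg2pi vec_eq_iff forall_2)

lemma norm_polar: "norm (polar r a) = \<bar>r\<bar>"
proof -
  have "(r * cos a)\<^sup>2 + (r * sin a)\<^sup>2 = r\<^sup>2"
    by (simp add: power_mult_distrib flip: distrib_left)
  then show ?thesis
    by (simp add: norm_vec2 polar_def complex_norm)
qed

lemma vec_angle_polar:
  assumes "0 < r" "0 \<le> a" "a < 2 * pi"
  shows "vec_angle (polar r a) = a"
  unfolding vec_angle_eq_Arg2pi
proof (rule Arg2pi_unique[OF _ assms])
  show "of_real r * exp (\<i> * of_real a) = Complex (polar r a $ 1) (polar r a $ 2)"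
    by (simp add: polar_def complex_eq_iff flip: cis_conv_exp)
qed

lemma rot_polar: "rot c (polar r a) = polar r (a + c)"
  by (simp add: rot_def polar_def vec_eq_iff forall_2 cos_add sin_add algebra_simps)

lemma orthogonal_transformation_rot: "orthogonal_transformation (rot c)"
  unfolding orthogonal_transformation
proof
  show "linear (rot c)"
    by (rule linearI) (simp_all add: rot_def vec_eq_iff forall_2 algebra_simps)
  show "\<forall>v. norm (rot c v) = norm v"
    by (metis norm_polar polar_eta rot_polar)
qed

text \<open>The angle jumps only across the positive horizontal axis, where it takes its least value
  0, as it does at the origin; hence it is lower semicontinuous. Borel measurability follows from
  this.\<close>

lemma closed_vec_angle_le: "closed {v. vec_angle v \<le> t}"
proof -
  have "closed ((\<lambda>v::real^2. Complex (v$1) (v$2)) -` {z. Arg2pi z \<le> t})"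
    by (intro closed_vimage closed_Arg2pi2pi_le) (auto simp: Complex_eq intro!: continuous_intros)
  then show ?thesis
    by (simp add: vec_angle_eq_Arg2pi vimage_def)
qed

lemma borel_measurable_vec_angle [measurable]: "vec_angle \<in> borel_measurable borel"
  by (intro borel_measurableI_le) (simp add: closed_vec_angle_le)

lemma sets_wedge [measurable]: "wedge r a b \<in> sets borel"
  unfolding wedge_def by measurable

lemma wedge_subset_cball: "wedge r a b \<subseteq> cball 0 r"
  by (auto simp: wedge_def)

lemma lmeasurable_wedge: "wedge r a b \<in> lmeasurable"
  by (rule bounded_set_imp_lmeasurable[OF bounded_subset[OF bounded_cball wedge_subset_cball]]) simp

text \<open>In polar coordinates the rotation adds \<open>c\<close> to the angle, and
  \<open>b + c <= 2 * pi\<close> excludes wrapping past a full turn. Preimages are found by turning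
  back by \<open>c\<close>.\<close>

lemma rot_image_wedge:
  assumes "0 \<le> a" "a \<le> b" "0 \<le> c" "b + c \<le> 2 * pi"
  shows "rot c ` wedge r a b = wedge r (a + c) (b + c)"
proof (intro equalityI subsetI)
  fix v assume "v \<in> rot c ` wedge r a b"
  then obtain u where u: "u \<in> wedge r a b" and v: "v = rot c u" by auto
  have v': "v = polar (norm u) (vec_angle u + c)"
    by (metis v polar_eta rot_polar)
  have "vec_angle v = vec_angle u + c" "norm v = norm u"
    using u assms by (auto simp: v' norm_polar wedge_def intro!: vec_angle_polar)
  then show "v \<in> wedge r (a + c) (b + c)"
    using u by (auto simp: wedge_def)
next
  fix v assume v: "v \<in> wedge r (a + c) (b + c)"
  define u where "u = polar (norm v) (vec_angle v - c)"
  have "vec_angle u = vec_angle v - c" "norm u = norm v"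
    using v assms by (auto simp: u_def norm_polar wedge_def intro!: vec_angle_polar)
  then have "u \<in> wedge r a b"
    using v by (auto simp: wedge_def)
  moreover have "v = rot c u"
    by (simp add: u_def rot_polar polar_eta)
  ultimately show "v \<in> rot c ` wedge r a b" by blast
qed

section \<open>Areas of the disc, of wedges and of closed sectors\<close>

lemma measure_disc:
  assumes "0 \<le> r" shows "measure lebesgue (cball (0 :: real^2) r) = pi * r\<^sup>2"
proof -
  have "unit_ball_vol (real (DIM(real^2))) = pi"
    by (simp add: unit_ball_vol_2)
  then show ?thesis
    using content_cball[OF assms, of "0 :: real^2"] by simp
qed

lemma measure_wedge_fraction:
  assumes "0 \<le> r" "0 < m" "k \<le> m"
  shows "measure lebesgue (wedge r 0 (2 * pi * real k / real m)) = real k / real m * (pi * r\<^sup>2)"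
proof -
  define d where "d = 2 * pi / real m"
  define W where "W j = wedge r (d * real j) (d * real (Suc j))" for j
  have d: "0 < d" "d * real m = 2 * pi"
    using assms by (auto simp: d_def)
  have W_eq: "measure lebesgue (W j) = measure lebesgue (W 0)" if "j < m" for j
  proof -
    have "d * real (Suc j) \<le> d * real m"
      using that d(1) by (intro mult_left_mono) auto
    then have "rot (d * real j) ` W 0 = W j"
      unfolding W_def using d by (subst rot_image_wedge) (auto simp: algebra_simps)
    then show ?thesis
      using measure_orthogonal_image[OF orthogonal_transformation_rot lmeasurable_wedge]
      unfolding W_def by metis
  qed
  have sum_eq: "measure lebesgue (wedge r 0 (d * real k)) = real k * measure lebesgue (W 0)"
    if "k \<le> m" for k
    using that
  proof (induction k)
    case 0
    then show ?case by (simp add: wedge_def vec_angle_bounds leD)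
  next
    case (Suc k)
    have "wedge r 0 (d * real (Suc k)) = wedge r 0 (d * real k) \<union> W k"
    proof -
      have "d * real k \<le> d * real (Suc k)" "0 \<le> d * real k"
        using d(1) by (auto intro!: mult_left_mono)
      then show ?thesis
        unfolding wedge_def W_def by (auto simp del: of_nat_Suc)
    qed
    moreover have "wedge r 0 (d * real k) \<inter> W k = {}"
      by (auto simp: wedge_def W_def)
    ultimately have "measure lebesgue (wedge r 0 (d * real (Suc k))) =
        measure lebesgue (wedge r 0 (d * real k)) + measure lebesgue (W k)"
      by (simp add: measure_Un3 lmeasurable_wedge W_def)
    then show ?case
      using Suc W_eq[of k] by (simp add: algebra_simps)
  qed
  \<comment> \<open>All \<open>m\<close> wedges together fill the disc up to the origin, a null set,
    and this fixes the area of \<open>W 0\<close>.\<close>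
  have "wedge r 0 (2 * pi) = cball 0 r - {0}"
    using vec_angle_bounds by (auto simp: wedge_def)
  moreover have "measure lebesgue (cball 0 r - {0 :: real^2}) = measure lebesgue (cball (0 :: real^2) r)"
    by (rule measure_negligible_symdiff) (auto intro: negligible_subset[of "{0}"])
  ultimately have "measure lebesgue (wedge r 0 (d * real m)) = pi * r\<^sup>2"
    using measure_disc[OF assms(1)] d by simp
  then have "measure lebesgue (W 0) = pi * r\<^sup>2 / real m"
    using sum_eq[of m] assms by (simp add: field_simps)
  then show ?thesis
    using sum_eq[OF assms(3)] by (simp add: d_def)
qed

text \<open>With \<open>Suc m\<close> equal steps per turn, the area of the sector and the claimed
  value both lie between the area of \<open>k\<close> steps and that of \<open>k + 1\<close> steps.
  These differ by \<open>pi * r^2 / Suc m\<close>, which tends to 0.\<close>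

lemma measure_sector_0:
  assumes "0 \<le> r" "0 < phi" "phi \<le> 2 * pi"
  shows "measure lebesgue {v. norm v \<le> r \<and> vec_angle v \<le> phi} = phi / 2 * r\<^sup>2"
proof -
  define S where "S = {v. norm v \<le> r \<and> vec_angle v \<le> phi}"
  have S_borel: "S \<in> sets borel" unfolding S_def by measurable
  have S_lm: "S \<in> lmeasurable"
  proof (rule bounded_set_imp_lmeasurable)
    show "bounded S"
      by (rule bounded_subset[OF bounded_cball[of 0 r]]) (auto simp: S_def)
  qed (use S_borel in simp)
  then have S_meas: "S - {0} \<in> lmeasurable"
    by (intro fmeasurable_Diff) auto
  have S0: "measure lebesgue (S - {0}) = measure lebesgue S"
    using S_lm by (intro measure_negligible_symdiff) (auto intro: negligible_subset[of "{0}"])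
  have bnd: "\<bar>measure lebesgue S - phi / 2 * r\<^sup>2\<bar> \<le> pi * r\<^sup>2 / real (Suc m)" for m
  proof -
    let ?m = "real (Suc m)"
    \<comment> \<open>The number of whole steps of size \<open>2 * pi / ?m\<close> that fit into
      \<open>phi\<close>.\<close>
    define k where "k = nat \<lfloor>phi * ?m / (2 * pi)\<rfloor>"
    have q: "0 \<le> phi * ?m / (2 * pi)" "phi * ?m / (2 * pi) \<le> ?m"
      using mult_right_mono[OF assms(3), of ?m] assms by (auto simp: pos_divide_le_eq mult.commute)
    have k: "real k \<le> phi * ?m / (2 * pi)" "phi * ?m / (2 * pi) < real k + 1"
      using q unfolding k_def by linarith+
    have km: "k \<le> Suc m" using k q by linarith
    have lo: "2 * pi * real k / ?m \<le> phi" and up: "phi < 2 * pi * (real k + 1) / ?m"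
      using k by (auto simp: field_simps)
    have "wedge r 0 (2 * pi * real k / ?m) \<subseteq> S - {0}"
      using lo by (auto simp: wedge_def S_def)
    then have "real k / ?m * (pi * r\<^sup>2) \<le> measure lebesgue (S - {0})"
      using measure_mono_fmeasurable[OF _ fmeasurableD[OF lmeasurable_wedge] S_meas]
      by (subst measure_wedge_fraction[OF assms(1) _ km, symmetric]) auto
    moreover have "measure lebesgue (S - {0}) \<le> (real k + 1) / ?m * (pi * r\<^sup>2)"
    proof (cases "k = Suc m")
      case False
      then have "Suc k \<le> Suc m" using km by simp
      moreover have "S - {0} \<subseteq> wedge r 0 (2 * pi * real (Suc k) / ?m)"
        using up vec_angle_bounds by (auto simp: wedge_def S_def add.commute intro: le_less_trans)
      ultimately have "measure lebesgue (S - {0}) \<le> real (Suc k) / ?m * (pi * r\<^sup>2)"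
        using measure_mono_fmeasurable[OF _ fmeasurableD[OF S_meas] lmeasurable_wedge]
        by (subst measure_wedge_fraction[OF assms(1), symmetric]) auto
      then show ?thesis by (simp add: add.commute)
    next
      \<comment> \<open>This happens only for \<open>phi = 2 * pi\<close>. One more step would
        exceed the full turn, beyond the range of the wedge formula, so the whole disc serves as the
        upper bound.\<close>
      case True
      have "measure lebesgue (S - {0}) \<le> pi * r\<^sup>2"
        unfolding measure_disc[OF assms(1), symmetric]
        using S_meas by (intro measure_mono_fmeasurable) (auto simp: S_def)
      also have "\<dots> \<le> (real k + 1) / ?m * (pi * r\<^sup>2)"
        using mult_right_mono[of 1 "(real k + 1) / ?m" "pi * r\<^sup>2"] True by simp
      finally show ?thesis .
    qed
    moreover have "real k / ?m * (pi * r\<^sup>2) \<le> phi / 2 * r\<^sup>2"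
    proof -
      have "real k / ?m * pi \<le> phi / 2" using lo by (simp add: field_simps)
      from mult_right_mono[OF this, of "r\<^sup>2"] show ?thesis by (simp add: ac_simps)
    qed
    moreover have "phi / 2 * r\<^sup>2 \<le> (real k + 1) / ?m * (pi * r\<^sup>2)"
    proof -
      have "phi / 2 \<le> (real k + 1) / ?m * pi" using up by (simp add: field_simps)
      from mult_right_mono[OF this, of "r\<^sup>2"] show ?thesis by (simp add: ac_simps)
    qed
    moreover have "(real k + 1) / ?m * (pi * r\<^sup>2) = real k / ?m * (pi * r\<^sup>2) + pi * r\<^sup>2 / ?m"
      by (simp add: add_divide_distrib distrib_right)
    ultimately show ?thesis
      unfolding S0 by linarith
  qed
  have "(\<lambda>m. pi * r\<^sup>2 / real (Suc m)) \<longlonglongrightarrow> 0"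
    by (rule LIMSEQ_Suc[OF lim_const_over_n])
  then have "\<bar>measure lebesgue S - phi / 2 * r\<^sup>2\<bar> \<le> 0"
    by (rule LIMSEQ_le_const) (use bnd in auto)
  then show ?thesis by (simp add: S_def)
qed

lemma emeasure_sector:
  fixes x :: "real^2"
  assumes "0 \<le> r" "0 < phi" "phi \<le> 2 * pi"
  shows "emeasure lborel {y. norm (y - x) \<le> r \<and> vec_angle (y - x) \<le> phi} = ennreal (phi / 2 * r\<^sup>2)"
proof -
  define S where "S = {v. norm v \<le> r \<and> vec_angle v \<le> phi}"
  have [measurable]: "S \<in> sets borel" unfolding S_def by measurable
  have "emeasure lborel {y. norm (y - x) \<le> r \<and> vec_angle (y - x) \<le> phi}
      = emeasure (distr lborel borel ((+) x)) {y. norm (y - x) \<le> r \<and> vec_angle (y - x) \<le> phi}"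
    by (simp add: lborel_distr_plus)
  also have "\<dots> = emeasure lborel S"
    by (subst emeasure_distr) (auto simp: S_def vimage_def)
  also have "emeasure lborel S = ennreal (measure lborel S)"
  proof -
    have "bounded S"
      by (rule bounded_subset[OF bounded_cball[of 0 r]]) (auto simp: S_def)
    then show ?thesis
      using emeasure_bounded_finite[OF \<open>bounded S\<close>] by (intro emeasure_eq_ennreal_measure) auto
  qed
  also have "measure lborel S = measure lebesgue S"
    by (rule measure_completion[symmetric]) simp
  also have "measure lebesgue S = phi / 2 * r\<^sup>2"
    unfolding S_def by (rule measure_sector_0[OF assms])
  finally show ?thesis .
qed

subsection \<open>Generating functional of a Poisson process\<close>

text \<open>By disjointness at most one term of a partial sum of
  \<open>f k * indicator (E k)\<close> is nonzero, so the partial sums are bounded by 1 and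
  dominated convergence applies. Measurability of \<open>g\<close> comes out of the same limit. The
  events need not cover the space, which leaves room for infinite counts.\<close>

lemma (in prob_space) expectation_disjoint_sums:
  fixes f :: "nat \<Rightarrow> real"
  assumes E [measurable]: "\<And>k. E k \<in> events" and disj: "disjoint_family E"
    and f: "\<And>k. \<bar>f k\<bar> \<le> 1"
    and g: "\<And>k w. w \<in> E k \<Longrightarrow> g w = f k"
    and g0: "\<And>w. w \<in> space M \<Longrightarrow> w \<notin> (\<Union>k. E k) \<Longrightarrow> g w = 0"
  shows "(\<lambda>k. f k * prob (E k)) sums expectation g"
proof -
  define S where "S K w = (\<Sum>k<K. f k * indicator (E k) w)" for K w
  have S_in: "S K w = (if j < K then f j else 0)" if "w \<in> E j" for K j w
  proof -
    have "indicator (E k) w = (if k = j then 1 else 0 :: real)" for k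
      using disj that unfolding disjoint_family_on_def by (auto simp: indicator_def)
    then have "S K w = (\<Sum>k<K. if k = j then f j else 0)"
      unfolding S_def by (intro sum.cong) auto
    then show ?thesis by simp
  qed
  have S_out: "S K w = 0" if "w \<notin> (\<Union>k. E k)" for K w
    using that by (auto simp: S_def indicator_def)
  have [measurable]: "S K \<in> borel_measurable M" for K
    unfolding S_def[abs_def] by measurable
  have lim: "(\<lambda>K. S K w) \<longlonglongrightarrow> g w" if "w \<in> space M" for w
  proof (cases "w \<in> (\<Union>k. E k)")
    case True
    then obtain j where j: "w \<in> E j" by auto
    have "eventually (\<lambda>K. S K w = g w) sequentially"
      using eventually_gt_at_top[of j] by eventually_elim (simp add: S_in[OF j] g[OF j])
    then show ?thesis by (rule tendsto_eventually)
  qed (use that in \<open>auto simp: S_out g0\<close>)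
  have "(\<lambda>K. expectation (S K)) \<longlonglongrightarrow> expectation g"
  proof (rule integral_dominated_convergence[where w="\<lambda>_. 1"])
    show "g \<in> borel_measurable M"
      by (rule borel_measurable_LIMSEQ_real[OF lim]) auto
    show "AE w in M. norm (S K w) \<le> 1" for K
    proof (rule AE_I2)
      fix w
      show "norm (S K w) \<le> 1"
        by (cases "w \<in> (\<Union>k. E k)") (auto simp: S_in S_out f)
    qed
  qed (use lim in auto)
  moreover have "expectation (S K) = (\<Sum>k<K. f k * prob (E k))" for K
    unfolding S_def by (subst Bochner_Integration.integral_sum) (auto simp: less_top[symmetric])
  ultimately show ?thesis by (simp add: sums_def)
qed

lemma exp_sums_real: "(\<lambda>k. (x :: real) ^ k / fact k) sums exp x"
  using exp_converges[of x] by (simp add: field_simps)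

lemma prod_bounds:
  fixes u :: "'a \<Rightarrow> real"
  assumes "\<And>y. 0 \<le> u y" "\<And>y. u y \<le> 1"
  shows "0 \<le> (\<Prod>i<(n::nat). 1 - u (x i))" "(\<Prod>i<n. 1 - u (x i)) \<le> 1"
  using assms by (auto intro!: prod_nonneg prod_le_1)

section \<open>The generating functional, from counts to integrable functions\<close>

locale poisson_process = prob_space M for M :: "'w measure" +
  fixes lam :: real and X :: "'w \<Rightarrow> nat \<Rightarrow> real^2"
  assumes ppp: "poisson_pp M lam X"
begin

lemma X_measurable [measurable]: "(\<lambda>w. X w i) \<in> borel_measurable M"
  using ppp by (simp add: poisson_pp_def)

lemma finite_bounded_count: "w \<in> space M \<Longrightarrow> bounded B \<Longrightarrow> finite {i. X w i \<in> B}"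
  using ppp by (simp add: poisson_pp_def)

lemma prob_pcount:
  "B \<in> sets borel \<Longrightarrow> bounded B \<Longrightarrow> prob {w \<in> space M. pcount (X w) B = k} =
     exp (- lam * measure lborel B) * (lam * measure lborel B) ^ k / fact k"
  using ppp by (simp add: poisson_pp_def)

lemma indep_pcount:
  fixes B :: "nat \<Rightarrow> (real^2) set"
  assumes "\<And>j. j < m \<Longrightarrow> B j \<in> sets borel" "\<And>j. j < m \<Longrightarrow> bounded (B j)"
    "disjoint_family_on B {..<m}"
  shows "indep_vars (\<lambda>_. count_space UNIV) (\<lambda>j w. pcount (X w) (B j)) {..<m}"
proof -
  have "\<forall>(B :: nat \<Rightarrow> (real^2) set) m.
        (\<forall>j<m. B j \<in> sets lborel \<and> bounded (B j)) \<longrightarrow> disjoint_family_on B {..<m} \<longrightarrow>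
        indep_vars (\<lambda>_. count_space UNIV) (\<lambda>j w. pcount (X w) (B j)) {..<m}"
    using ppp unfolding poisson_pp_def by blast
  from this[rule_format, of m B] show ?thesis using assms by simp
qed

lemma pcount_measurable [measurable]:
  assumes [measurable]: "B \<in> sets borel"
  shows "(\<lambda>w. pcount (X w) B) \<in> measurable M (count_space UNIV)"
  unfolding pcount_def by measurable

text \<open>The Poisson generating function at \<open>1 - c\<close>. It is the generating functional
  for the constant \<open>c\<close> on \<open>B\<close>, the building block for simple
  functions.\<close>

lemma expectation_power_pcount:
  assumes B: "B \<in> sets borel" "bounded B" and c: "0 \<le> c" "c \<le> 1"
  shows "expectation (\<lambda>w. (1 - c) ^ pcount (X w) B) = exp (- lam * (c * measure lborel B))"
proof -
  note [measurable] = B(1)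
  let ?r = "lam * measure lborel B"
  have "(\<lambda>k. (1 - c) ^ k * prob {w \<in> space M. pcount (X w) B = k}) sums
          expectation (\<lambda>w. (1 - c) ^ pcount (X w) B)"
  proof (rule expectation_disjoint_sums)
    show "disjoint_family (\<lambda>k. {w \<in> space M. pcount (X w) B = k})"
      by (auto simp: disjoint_family_on_def)
    show "\<bar>(1 - c) ^ k\<bar> \<le> 1" for k
      using c by (simp add: power_abs power_le_one)
  qed auto
  moreover have "(\<lambda>k. (1 - c) ^ k * prob {w \<in> space M. pcount (X w) B = k}) sums
      (exp (- ?r) * exp (?r * (1 - c)))"
    using sums_mult[OF exp_sums_real[of "?r * (1 - c)"], of "exp (- ?r)"]
    by (simp add: prob_pcount[OF B] power_mult_distrib ac_simps)
  ultimately have "expectation (\<lambda>w. (1 - c) ^ pcount (X w) B) = exp (- ?r) * exp (?r * (1 - c))"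
    by (rule sums_unique2)
  then show ?thesis
    by (simp add: algebra_simps flip: exp_add)
qed

lemma prod_measurable:
  fixes u :: "real^2 \<Rightarrow> real"
  assumes [measurable]: "u \<in> borel_measurable borel"
  shows "(\<lambda>w. \<Prod>i<n. 1 - u (X w i)) \<in> borel_measurable M"
  by measurable

lemma prod_integrable:
  fixes u :: "real^2 \<Rightarrow> real"
  assumes "u \<in> borel_measurable borel" "\<And>y. 0 \<le> u y" "\<And>y. u y \<le> 1"
  shows "integrable M (\<lambda>w. \<Prod>i<n. 1 - u (X w i))"
  using prod_bounds[of u] assms
  by (intro integrable_const_bound[where B=1] prod_measurable) (auto simp: abs_le_iff intro: order_trans)

text \<open>Grouping the points by the value of \<open>u\<close> turns the product into one power
  per nonzero value \<open>v\<close>, with the count of the level set \<open>B v\<close> as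
  exponent. Level sets are disjoint and bounded, so these counts are independent Poisson variables
  and the expectation factorises.\<close>

lemma expectation_prod_simple:
  fixes u :: "real^2 \<Rightarrow> real"
  assumes u [measurable]: "u \<in> borel_measurable borel" and u0: "\<And>y. 0 \<le> u y" and u1: "\<And>y. u y \<le> 1"
    and fin: "finite (range u)" and bd: "bounded {y. u y \<noteq> 0}"
  shows "(\<lambda>n. expectation (\<lambda>w. \<Prod>i<n. 1 - u (X w i))) \<longlonglongrightarrow> exp (- lam * (\<integral>y. u y \<partial>lborel))"
proof -
  define V where "V = range u - {0}"
  have finV: "finite V" using fin by (simp add: V_def)
  \<comment> \<open>The independence axiom speaks of families indexed by an initial segment of the
    naturals, so the nonzero values are enumerated that way.\<close>
  obtain e where e: "bij_betw e {..<card V} V"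
    using ex_bij_betw_nat_finite[OF finV] by (auto simp: atLeast0LessThan)
  define B where "B v = {y. u y = v}" for v
  have B_meas [measurable]: "B v \<in> sets borel" for v
    unfolding B_def by measurable
  have B_bd: "bounded (B v)" if "v \<in> V" for v
    using that by (intro bounded_subset[OF bd]) (auto simp: B_def V_def)
  have eV: "e j \<in> V" if "j < card V" for j
    using e that by (auto simp: bij_betw_def)
  have V01: "0 \<le> v" "v \<le> 1" if "v \<in> V" for v
    using that u0 u1 by (auto simp: V_def)
  define Z where "Z w = (\<Prod>v\<in>V. (1 - v) ^ pcount (X w) (B v))" for w
  have lim: "(\<lambda>n. \<Prod>i<n. 1 - u (X w i)) \<longlonglongrightarrow> Z w" if w: "w \<in> space M" for w
  proof -
    \<comment> \<open>Only finitely many points lie in the bounded support; the other factors are 1,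
      so the partial products are eventually constant.\<close>
    define F where "F = {i. X w i \<in> {y. u y \<noteq> 0}}"
    have finF: "finite F"
      unfolding F_def by (rule finite_bounded_count[OF w bd])
    have Zw: "Z w = (\<Prod>i\<in>F. 1 - u (X w i))"
    proof -
      have "(\<Prod>i\<in>F. 1 - u (X w i)) = (\<Prod>v\<in>V. \<Prod>i | i \<in> F \<and> u (X w i) = v. 1 - u (X w i))"
        by (rule prod.group[symmetric]) (use finF finV in \<open>auto simp: F_def V_def\<close>)
      also have "\<dots> = Z w"
        unfolding Z_def
      proof (rule prod.cong[OF refl])
        fix v assume "v \<in> V"
        then have "{i. i \<in> F \<and> u (X w i) = v} = {i. X w i \<in> B v}"
          by (auto simp: F_def B_def V_def)
        then show "(\<Prod>i | i \<in> F \<and> u (X w i) = v. 1 - u (X w i)) = (1 - v) ^ pcount (X w) (B v)"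
          by (simp add: pcount_def B_def)
      qed
      finally show ?thesis by simp
    qed
    obtain K where K: "F \<subseteq> {..<K}"
      using finF finite_nat_iff_bounded by blast
    have "eventually (\<lambda>n. (\<Prod>i<n. 1 - u (X w i)) = Z w) sequentially"
      using eventually_ge_at_top[of K]
    proof eventually_elim
      case (elim n)
      then show ?case
        unfolding Zw using K by (intro prod.mono_neutral_right) (auto simp: F_def)
    qed
    then show ?thesis by (rule tendsto_eventually)
  qed
  have "(\<lambda>n. expectation (\<lambda>w. \<Prod>i<n. 1 - u (X w i))) \<longlonglongrightarrow> expectation Z"
  proof (rule integral_dominated_convergence[where w="\<lambda>_. 1"])
    show "Z \<in> borel_measurable M"
      unfolding Z_def[abs_def] by measurable
    show "AE w in M. norm (\<Prod>i<n. 1 - u (X w i)) \<le> 1" for n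
      using prod_bounds[of u, OF u0 u1] by (auto simp: abs_le_iff intro: order_trans)
  qed (use lim in auto)
  also have "expectation Z = (\<Prod>v\<in>V. exp (- lam * (v * measure lborel (B v))))"
  proof -
    have "expectation Z = expectation (\<lambda>w. \<Prod>j<card V. (1 - e j) ^ pcount (X w) (B (e j)))"
      unfolding Z_def by (subst prod.reindex_bij_betw[OF e, symmetric]) simp
    also have "\<dots> = (\<Prod>j<card V. expectation (\<lambda>w. (1 - e j) ^ pcount (X w) (B (e j))))"
    proof (rule indep_vars_lebesgue_integral)
      have "disjoint_family_on (\<lambda>j. B (e j)) {..<card V}"
        using bij_betw_imp_inj_on[OF e] by (auto simp: disjoint_family_on_def B_def inj_on_def)
      then have "indep_vars (\<lambda>_. count_space UNIV) (\<lambda>j w. pcount (X w) (B (e j))) {..<card V}"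
        using B_bd eV by (intro indep_pcount) auto
      then show "indep_vars (\<lambda>_. borel) (\<lambda>j w. (1 - e j) ^ pcount (X w) (B (e j))) {..<card V}"
        by (rule indep_vars_compose2) auto
      show "integrable M (\<lambda>w. (1 - e j) ^ pcount (X w) (B (e j)))" if "j \<in> {..<card V}" for j
        using that V01[OF eV[of j]]
        by (intro integrable_const_bound[where B=1]) (auto simp: power_abs power_le_one)
    qed auto
    also have "\<dots> = (\<Prod>j<card V. exp (- lam * (e j * measure lborel (B (e j)))))"
      using V01 eV B_bd by (intro prod.cong refl expectation_power_pcount) auto
    also have "\<dots> = (\<Prod>v\<in>V. exp (- lam * (v * measure lborel (B v))))"
      by (rule prod.reindex_bij_betw[OF e])
    finally show ?thesis .
  qed
  also have "\<dots> = exp (- lam * (\<Sum>v\<in>V. v * measure lborel (B v)))"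
    using finV by (simp add: sum_distrib_left exp_sum flip: sum_negf)
  also have "(\<Sum>v\<in>V. v * measure lborel (B v)) = (\<integral>y. u y \<partial>lborel)"
  proof -
    have "u y = (\<Sum>v\<in>V. v * indicator (B v) y)" for y
    proof -
      have "(\<Sum>v\<in>V. v * indicator (B v) y) = (\<Sum>v\<in>V. if v = u y then u y else 0)"
        by (rule sum.cong) (auto simp: B_def indicator_def)
      then show ?thesis
        using finV by (auto simp: V_def)
    qed
    then have "(\<integral>y. u y \<partial>lborel) = (\<integral>y. (\<Sum>v\<in>V. v * indicator (B v) y) \<partial>lborel)"
      by simp
    also have "\<dots> = (\<Sum>v\<in>V. \<integral>y. v * indicator (B v) y \<partial>lborel)"
      using emeasure_bounded_finite[OF B_bd]
      by (intro Bochner_Integration.integral_sum integrable_mult_right integrable_real_indicator) auto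
    finally show ?thesis by simp
  qed
  finally show ?thesis .
qed

text \<open>The probability generating functional, with the infinite product over the points replaced
  by the decreasing sequence of its partial products. Rounding the function down makes it simple with
  bounded support; the two monotone limits then pinch the general value.\<close>

lemma expectation_prod_tendsto:
  fixes u :: "real^2 \<Rightarrow> real"
  assumes u [measurable]: "u \<in> borel_measurable borel" and u0: "\<And>y. 0 \<le> u y" and u1: "\<And>y. u y \<le> 1"
    and int: "integrable lborel u"
  shows "(\<lambda>n. expectation (\<lambda>w. \<Prod>i<n. 1 - u (X w i))) \<longlonglongrightarrow> exp (- lam * (\<integral>y. u y \<partial>lborel))"
proof -
  define U where "U k y = of_int \<lfloor>u y * real (Suc k)\<rfloor> / real (Suc k) * indicator (cball 0 (real k)) y" for k y
  have [measurable]: "cball (0 :: real^2) (real k) \<in> sets borel" for k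
    by simp
  have U_meas [measurable]: "U k \<in> borel_measurable borel" for k
    unfolding U_def[abs_def] by (intro borel_measurable_times borel_measurable_indicator) measurable
  have U0: "0 \<le> U k y" for k y
    using u0[of y] by (auto simp: U_def)
  have Uu: "U k y \<le> u y" for k y
  proof -
    have "of_int \<lfloor>u y * real (Suc k)\<rfloor> / real (Suc k) \<le> u y"
      by (simp add: pos_divide_le_eq del: of_nat_Suc)
    then show ?thesis using u0[of y] by (auto simp: U_def indicator_def)
  qed
  have U1: "U k y \<le> 1" for k y
    using Uu[of k y] u1[of y] by simp
  have U_lim: "(\<lambda>k. U k y) \<longlonglongrightarrow> u y" for y
  proof (rule tendsto_sandwich)
    obtain K where K: "norm y \<le> real K" using real_arch_simple by blast
    show "eventually (\<lambda>k. u y - 1 / real (Suc k) \<le> U k y) sequentially"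
      using eventually_ge_at_top[of K]
    proof eventually_elim
      case (elim k)
      have "u y * real (Suc k) - 1 \<le> of_int \<lfloor>u y * real (Suc k)\<rfloor>" by linarith
      then have "u y - 1 / real (Suc k) \<le> of_int \<lfloor>u y * real (Suc k)\<rfloor> / real (Suc k)"
        by (simp add: pos_le_divide_eq left_diff_distrib del: of_nat_Suc)
      moreover have "norm y \<le> real k" using K elim by linarith
      ultimately show ?case by (simp add: U_def)
    qed
    show "(\<lambda>k. u y - 1 / real (Suc k)) \<longlonglongrightarrow> u y"
      using tendsto_diff[OF tendsto_const[of "u y"] LIMSEQ_Suc[OF lim_1_over_n]] by simp
  qed (use Uu in auto)
  \<comment> \<open>The two limits are taken in both orders. Letting \<open>k\<close> grow in
    \<open>L k <= a k n\<close> gives \<open>L' <= b n\<close>. Letting \<open>n\<close> grow in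
    \<open>b n <= a k n\<close> bounds the limit of \<open>b\<close> by every \<open>L k\<close>,
    hence by \<open>L'\<close>.\<close>
  define a where "a k n = expectation (\<lambda>w. \<Prod>i<n. 1 - U k (X w i))" for k n
  define b where "b n = expectation (\<lambda>w. \<Prod>i<n. 1 - u (X w i))" for n
  define L where "L k = exp (- lam * (\<integral>y. U k y \<partial>lborel))" for k
  define L' where "L' = exp (- lam * (\<integral>y. u y \<partial>lborel))"
  have aL: "a k \<longlonglongrightarrow> L k" for k
    unfolding a_def[abs_def] L_def
  proof (rule expectation_prod_simple)
    have "range (U k) \<subseteq> (\<lambda>j. of_int j / real (Suc k)) ` {0..int (Suc k)} \<union> {0}"
    proof
      fix v assume "v \<in> range (U k)"
      then obtain y where v: "v = U k y" by auto
      have "0 \<le> \<lfloor>u y * real (Suc k)\<rfloor>" using u0[of y] by simp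
      moreover have "u y * real (Suc k) \<le> real (Suc k)"
        using mult_right_mono[OF u1[of y], of "real (Suc k)"] by simp
      then have "\<lfloor>u y * real (Suc k)\<rfloor> \<le> int (Suc k)"
        by linarith
      ultimately show "v \<in> (\<lambda>j. of_int j / real (Suc k)) ` {0..int (Suc k)} \<union> {0}"
        unfolding v U_def by (cases "y \<in> cball 0 (real k)") auto
    qed
    then show "finite (range (U k))"
      by (rule finite_subset) auto
    show "bounded {y. U k y \<noteq> 0}"
      by (rule bounded_subset[OF bounded_cball[of 0 "real k"]]) (auto simp: U_def indicator_def)
  qed (use U0 U1 in auto)
  \<comment> \<open>All factors lie in [0, 1], so the partial products decrease; a limit is
    therefore a lower bound for each of them.\<close>
  have dec: "decseq (\<lambda>n. expectation (\<lambda>w. \<Prod>i<n. 1 - v (X w i)))"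
    if [measurable]: "v \<in> borel_measurable borel" and v: "\<And>y. 0 \<le> v y" "\<And>y. v y \<le> 1"
    for v :: "real^2 \<Rightarrow> real"
  proof (rule decseq_SucI, rule integral_mono)
    show "(\<Prod>i<Suc n. 1 - v (X w i)) \<le> (\<Prod>i<n. 1 - v (X w i))" for n w
    proof -
      have "0 \<le> (\<Prod>i<n. 1 - v (X w i))" using v by (intro prod_nonneg) simp
      then show ?thesis using v by (simp add: mult_left_le)
    qed
  qed (intro prod_integrable that)+
  have La: "L k \<le> a k n" for k n
    using decseq_ge[OF dec[OF U_meas U0 U1] aL[unfolded a_def[abs_def]]] by (simp add: a_def)
  have ba: "b n \<le> a k n" for k n
    unfolding a_def b_def
    by (intro integral_mono prod_integrable prod_mono) (use U0 U1 u0 u1 Uu in auto)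
  have LL': "L \<longlonglongrightarrow> L'"
  proof -
    have "(\<lambda>k. \<integral>y. U k y \<partial>lborel) \<longlonglongrightarrow> (\<integral>y. u y \<partial>lborel)"
      by (rule integral_dominated_convergence[where w=u]) (use U_lim U0 Uu int in auto)
    then show ?thesis
      unfolding L_def[abs_def] L'_def by (intro tendsto_intros)
  qed
  have ab: "(\<lambda>k. a k n) \<longlonglongrightarrow> b n" for n
    unfolding a_def b_def
  proof (rule integral_dominated_convergence[where w="\<lambda>_. 1"])
    show "AE w in M. norm (\<Prod>i<n. 1 - U k (X w i)) \<le> 1" for k
      using prod_bounds[of "U k", OF U0 U1] by (auto simp: abs_le_iff intro: order_trans)
    show "AE w in M. (\<lambda>k. \<Prod>i<n. 1 - U k (X w i)) \<longlonglongrightarrow> (\<Prod>i<n. 1 - u (X w i))"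
      by (intro AE_I2 tendsto_prod tendsto_diff tendsto_const U_lim)
  qed auto
  have lower: "L' \<le> b n" for n
    by (rule LIMSEQ_le[OF LL' ab]) (use La in auto)
  obtain \<beta> where \<beta>: "b \<longlonglongrightarrow> \<beta>"
    using decseq_convergent[of b L'] dec[OF u u0 u1] lower unfolding b_def[abs_def] by blast
  have "\<beta> \<le> L k" for k
    by (rule LIMSEQ_le[OF \<beta> aL]) (use ba in auto)
  then have "\<beta> \<le> L'"
    by (intro LIMSEQ_le_const[OF LL']) auto
  moreover have "L' \<le> \<beta>"
    by (rule LIMSEQ_le_const[OF \<beta>]) (use lower in auto)
  ultimately show ?thesis
    using \<beta> by (simp add: b_def[abs_def] L'_def)
qed

end

subsection \<open>Independent marks\<close>

text \<open>Strong induction on the index: once the lower coefficients of the difference vanish,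
  dividing by \<open>s ^ n\<close> leaves a series whose sum is 0 on (0, 1) and whose limit at 0 is
  the coefficient \<open>d n\<close>.\<close>

lemma powser_coeffs_unique:
  fixes a b :: "nat \<Rightarrow> real"
  assumes a: "\<And>s. 0 < s \<Longrightarrow> s < 1 \<Longrightarrow> (\<lambda>n. a n * s ^ n) sums F s"
    and b: "\<And>s. 0 < s \<Longrightarrow> s < 1 \<Longrightarrow> (\<lambda>n. b n * s ^ n) sums F s"
  shows "a n = b n"
proof -
  define d where "d n = a n - b n" for n
  have d: "(\<lambda>n. d n * s ^ n) sums 0" if "0 < s" "s < 1" for s
    using sums_diff[OF a[OF that] b[OF that]] by (simp add: d_def left_diff_distrib)
  have "d n = 0" for n
  proof (induction n rule: less_induct)
    case (less n)
    have shift: "(\<lambda>k. d (k + n) * s ^ k) sums 0" if s: "0 < s" "s < 1" for s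
    proof -
      have "(\<lambda>k. d (k + n) * s ^ (k + n)) sums 0"
        using sums_split_initial_segment[OF d[OF s], of n] less.IH by simp
      from sums_mult[OF this, of "inverse (s ^ n)"] show ?thesis
        using s by (simp add: power_add field_simps)
    qed
    define f where "f s = (\<Sum>k. d (k + n) * s ^ k)" for s
    have "(f \<longlongrightarrow> d (0 + n)) (at 0)"
    proof (rule powser_limit_0_strong[of 1])
      fix s :: real assume "norm s < 1"
      \<comment> \<open>The sums are known for positive arguments only. A positive \<open>t\<close>
        with \<open>norm s < t < 1\<close> yields convergence at \<open>s\<close> of either sign, as
        the two-sided limit requires.\<close>
      then obtain t where "norm s < t" "t < 1" using dense by blast
      moreover from this have "0 < t" using norm_ge_zero[of s] by linarith
      ultimately have "summable (\<lambda>k. d (k + n) * s ^ k)"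
        using powser_inside[OF sums_summable[OF shift[of t]], of s] by simp
      then show "(\<lambda>k. d (k + n) * s ^ k) sums f s"
        unfolding f_def by (rule summable_sums)
    qed simp
    then have "(f \<longlongrightarrow> d n) (at_right 0)"
      by (simp add: filterlim_at_split)
    moreover have "(f \<longlongrightarrow> 0) (at_right 0)"
    proof (rule tendsto_eventually)
      have "eventually (\<lambda>s::real. s \<in> {0<..<1}) (at_right 0)"
        by (rule eventually_at_right_real) simp
      then show "eventually (\<lambda>s. f s = 0) (at_right 0)"
        by eventually_elim (use sums_unique[OF shift] in \<open>auto simp: f_def\<close>)
    qed
    ultimately show ?case
      by (rule tendsto_unique[rotated]) simp
  qed
  then show ?thesis by (simp add: d_def)
qed

text \<open>The case split is forced by \<open>card A = 0\<close> for infinite \<open>A\<close>: the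
  powers then tend to 0, whereas \<open>s ^ card A\<close> would be 1.\<close>

lemma power_card_tendsto:
  fixes s :: real and A :: "nat set"
  assumes "0 \<le> s" "s < 1"
  shows "(\<lambda>n. s ^ card (A \<inter> {..<n})) \<longlonglongrightarrow> (if finite A then s ^ card A else 0)"
proof (cases "finite A")
  case True
  then obtain K where K: "A \<subseteq> {..<K}"
    using finite_nat_iff_bounded by blast
  have "eventually (\<lambda>n. s ^ card (A \<inter> {..<n}) = s ^ card A) sequentially"
    using eventually_ge_at_top[of K]
  proof eventually_elim
    case (elim n)
    then have "A \<inter> {..<n} = A" using K by auto
    then show ?case by simp
  qed
  then show ?thesis
    using True by (simp add: tendsto_eventually)
next
  case False
  have "filterlim (\<lambda>n. card (A \<inter> {..<n})) at_top sequentially"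
    unfolding filterlim_at_top
  proof
    fix Z
    obtain B where B: "B \<subseteq> A" "finite B" "card B = Z"
      using infinite_arbitrarily_large[OF False] by blast
    then obtain K where K: "B \<subseteq> {..<K}"
      using finite_nat_iff_bounded by blast
    show "eventually (\<lambda>n. Z \<le> card (A \<inter> {..<n})) sequentially"
      using eventually_ge_at_top[of K]
    proof eventually_elim
      case (elim n)
      then have "B \<subseteq> A \<inter> {..<n}" using K B by auto
      then show ?case using B(3) card_mono[of "A \<inter> {..<n}" B] by simp
    qed
  qed
  from filterlim_compose[OF LIMSEQ_realpow_zero[OF assms] this] show ?thesis
    using False by simp
qed

section \<open>Thinning a Poisson process by independent marks\<close>

locale marked_poisson_process = poisson_process M lam X
  for M :: "'w measure" and lam and X :: "'w \<Rightarrow> nat \<Rightarrow> real^2" +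
  fixes H :: "'w \<Rightarrow> nat \<Rightarrow> real" and D :: "real measure"
  assumes H_distr: "\<And>i. distr M borel (\<lambda>w. H w i) = D"
    and H_indep: "indep_vars (\<lambda>_. borel) (\<lambda>i w. H w i) UNIV"
    and XH_indep: "indep_set
          (sets (vimage_algebra (space M) X (Pi\<^sub>M UNIV (\<lambda>_. borel))))
          (sets (vimage_algebra (space M) H (Pi\<^sub>M UNIV (\<lambda>_. borel))))"
begin

lemma H_measurable [measurable]: "(\<lambda>w. H w i) \<in> borel_measurable M"
  using H_indep by (auto simp: indep_vars_def)

lemma sets_D [measurable_cong, simp]: "sets D = sets borel"
  using H_distr[of 0] by auto

lemma space_D [simp]: "space D = UNIV"
  using H_distr[of 0] by auto

lemma prob_space_D: "prob_space D"
  unfolding H_distr[of 0, symmetric] by (rule prob_space_distr) simp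

text \<open>The probability \<open>q(y)\<close> of the opening outline.\<close>

definition hit_prob :: "((real^2) \<times> real) set \<Rightarrow> real^2 \<Rightarrow> real" where
  "hit_prob G y = measure D {h. (y, h) \<in> G}"

lemma hit_prob_bounds: "0 \<le> hit_prob G y" "hit_prob G y \<le> 1"
  using prob_space.prob_le_1[OF prob_space_D] by (simp_all add: hit_prob_def)

lemma hit_prob_measurable [measurable]:
  assumes G: "G \<in> sets (borel \<Otimes>\<^sub>M borel)"
  shows "hit_prob G \<in> borel_measurable borel"
proof -
  interpret D: prob_space D by (rule prob_space_D)
  have "G \<in> sets (borel \<Otimes>\<^sub>M D)" using G by simp
  from D.measurable_emeasure_Pair[OF this] show ?thesis
    unfolding hit_prob_def[abs_def] measure_def vimage_def by simp
qed

lemma expectation_mark: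
  assumes G [measurable]: "G \<in> sets (borel \<Otimes>\<^sub>M borel)"
  shows "expectation (\<lambda>w. if (y, H w i) \<in> G then s else 1) = 1 - (1 - s) * hit_prob G y"
proof -
  interpret D: prob_space D by (rule prob_space_D)
  have Gy [measurable]: "{h. (y, h) \<in> G} \<in> sets borel"
    by measurable
  have "expectation (\<lambda>w. if (y, H w i) \<in> G then s else 1) = (\<integral>h. (if (y, h) \<in> G then s else 1) \<partial>D)"
    unfolding H_distr[of i, symmetric] by (subst integral_distr) auto
  also have "\<dots> = (\<integral>h. 1 - (1 - s) * indicator {h. (y, h) \<in> G} h \<partial>D)"
    by (rule Bochner_Integration.integral_cong) (auto simp: indicator_def)
  also have "\<dots> = 1 - (1 - s) * hit_prob G y"
    using D.prob_space by (subst Bochner_Integration.integral_diff)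
      (auto simp: hit_prob_def D.emeasure_finite less_top[symmetric])
  finally show ?thesis .
qed

text \<open>Averages the marks out first. Independence of \<open>X\<close> and \<open>H\<close>
  makes their joint law a product measure, so Fubini integrates over the marks with the point
  configuration held fixed.\<close>

lemma expectation_marked_prod:
  assumes G [measurable]: "G \<in> sets (borel \<Otimes>\<^sub>M borel)" and s: "0 \<le> s" "s \<le> 1"
  shows "expectation (\<lambda>w. \<Prod>i<n. if (X w i, H w i) \<in> G then s else 1) =
         expectation (\<lambda>w. \<Prod>i<n. 1 - (1 - s) * hit_prob G (X w i))"
proof -
  let ?PX = "Pi\<^sub>M UNIV (\<lambda>_. borel) :: (nat \<Rightarrow> real^2) measure"
  let ?PH = "Pi\<^sub>M UNIV (\<lambda>_. borel) :: (nat \<Rightarrow> real) measure"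
  define g where "g p = (if p \<in> G then s else 1)" for p
  have [measurable]: "g \<in> borel_measurable (borel \<Otimes>\<^sub>M borel)"
    unfolding g_def by measurable
  have g01: "0 \<le> g p" "g p \<le> 1" for p using s by (auto simp: g_def)
  have X_rv [measurable]: "X \<in> measurable M ?PX" and H_rv [measurable]: "H \<in> measurable M ?PH"
    using measurable_abs_UNIV[of "\<lambda>i w. X w i" M "\<lambda>_. borel"]
      measurable_abs_UNIV[of "\<lambda>i w. H w i" M "\<lambda>_. borel"] by auto
  interpret PX: prob_space "distr M ?PX X" by (rule prob_space_distr) simp
  interpret PH: prob_space "distr M ?PH H" by (rule prob_space_distr) simp
  interpret P: pair_prob_space "distr M ?PX X" "distr M ?PH H" ..
  \<comment> \<open>\<open>indep_var\<close> would force points and marks to have the same type.\<close>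
  have joint: "distr M ?PX X \<Otimes>\<^sub>M distr M ?PH H = distr M (?PX \<Otimes>\<^sub>M ?PH) (\<lambda>w. (X w, H w))"
  proof (rule pair_measure_eqI)
    fix A B assume A: "A \<in> sets (distr M ?PX X)" and B: "B \<in> sets (distr M ?PH H)"
    have "X -` A \<inter> space M \<in> sets (vimage_algebra (space M) X ?PX)"
      "H -` B \<inter> space M \<in> sets (vimage_algebra (space M) H ?PH)"
      using A B by (auto intro: in_vimage_algebra)
    then have "prob ((X -` A \<inter> space M) \<inter> (H -` B \<inter> space M)) = prob (X -` A \<inter> space M) * prob (H -` B \<inter> space M)"
      by (rule indep_setD[OF XH_indep])
    moreover have "(\<lambda>w. (X w, H w)) -` (A \<times> B) \<inter> space M = (X -` A \<inter> space M) \<inter> (H -` B \<inter> space M)"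
      by auto
    ultimately show "emeasure (distr M ?PX X) A * emeasure (distr M ?PH H) B =
        emeasure (distr M (?PX \<Otimes>\<^sub>M ?PH) (\<lambda>w. (X w, H w))) (A \<times> B)"
      using A B by (simp add: emeasure_distr emeasure_eq_measure ennreal_mult)
  qed (auto intro: PX.sigma_finite_measure_axioms PH.sigma_finite_measure_axioms)
  define \<Psi> where "\<Psi> p = (\<Prod>i<n. g (fst p i, snd p i))" for p
  have \<Psi>_meas [measurable]: "\<Psi> \<in> borel_measurable (?PX \<Otimes>\<^sub>M ?PH)"
    unfolding \<Psi>_def by measurable
  have "\<bar>\<Psi> p\<bar> \<le> 1" for p
    unfolding \<Psi>_def using g01 by (simp add: abs_prod prod_le_1)
  then have \<Psi>_int: "integrable (distr M ?PX X \<Otimes>\<^sub>M distr M ?PH H) \<Psi>"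
    by (intro P.integrable_const_bound[where B=1]) auto
  have "expectation (\<lambda>w. \<Prod>i<n. g (X w i, H w i)) = (\<integral>p. \<Psi> p \<partial>distr M (?PX \<Otimes>\<^sub>M ?PH) (\<lambda>w. (X w, H w)))"
    by (subst integral_distr) (auto simp: \<Psi>_def)
  also have "\<dots> = (\<integral>\<xi>. (\<integral>\<eta>. \<Psi> (\<xi>, \<eta>) \<partial>distr M ?PH H) \<partial>distr M ?PX X)"
    unfolding joint[symmetric] using P.integral_fst'[OF \<Psi>_int] by simp
  also have "\<dots> = (\<integral>\<xi>. (\<Prod>i<n. 1 - (1 - s) * hit_prob G (\<xi> i)) \<partial>distr M ?PX X)"
  \<comment> \<open>For a frozen configuration the factors depend on distinct independent marks, so
    the expectation of their product is the product of their expectations.\<close>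
  proof (rule Bochner_Integration.integral_cong[OF refl])
    fix \<xi> :: "nat \<Rightarrow> real^2"
    have "(\<integral>\<eta>. \<Psi> (\<xi>, \<eta>) \<partial>distr M ?PH H) = expectation (\<lambda>w. \<Prod>i<n. g (\<xi> i, H w i))"
      by (subst integral_distr) (auto simp: \<Psi>_def)
    also have "\<dots> = (\<Prod>i<n. expectation (\<lambda>w. g (\<xi> i, H w i)))"
    proof (rule indep_vars_lebesgue_integral)
      have "indep_vars (\<lambda>_. borel) (\<lambda>i w. H w i) {..<n}"
        by (rule indep_vars_subset[OF H_indep]) simp
      then show "indep_vars (\<lambda>_. borel) (\<lambda>i w. g (\<xi> i, H w i)) {..<n}"
        by (rule indep_vars_compose2) measurable
      show "integrable M (\<lambda>w. g (\<xi> i, H w i))" for i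
        using g01 by (intro integrable_const_bound[where B=1]) auto
    qed simp
    also have "\<dots> = (\<Prod>i<n. 1 - (1 - s) * hit_prob G (\<xi> i))"
      unfolding g_def by (simp add: expectation_mark)
    finally show "(\<integral>\<eta>. \<Psi> (\<xi>, \<eta>) \<partial>distr M ?PH H) = \<dots>" .
  qed
  also have "\<dots> = expectation (\<lambda>w. \<Prod>i<n. 1 - (1 - s) * hit_prob G (X w i))"
    by (subst integral_distr) auto
  finally show ?thesis by (simp add: g_def)
qed

definition hits :: "((real^2) \<times> real) set \<Rightarrow> 'w \<Rightarrow> nat set" where
  "hits G w = {i. (X w i, H w i) \<in> G}"

lemma hits_measurable [measurable]:
  assumes [measurable]: "G \<in> sets (borel \<Otimes>\<^sub>M borel)"
  shows "Measurable.pred M (\<lambda>w. i \<in> hits G w)"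
  unfolding hits_def by measurable

text \<open>The generating functional is applied to \<open>(1 - s) * hit_prob G\<close>; the partial
  product over the first \<open>n\<close> points is \<open>s\<close> to the number of hits among
  them. In the limit, outcomes with infinitely many hits contribute 0.\<close>

lemma expectation_power_hits:
  assumes G [measurable]: "G \<in> sets (borel \<Otimes>\<^sub>M borel)" and s: "0 \<le> s" "s < 1"
    and int: "integrable lborel (hit_prob G)"
  shows "expectation (\<lambda>w. if finite (hits G w) then s ^ card (hits G w) else 0) =
         exp (- lam * ((1 - s) * (\<integral>y. hit_prob G y \<partial>lborel)))"
proof -
  have prod_eq: "(\<Prod>i<n. if (X w i, H w i) \<in> G then s else 1) = s ^ card (hits G w \<inter> {..<n})" for w n
  proof -
    have "(\<Prod>i<n. if (X w i, H w i) \<in> G then s else 1) = (\<Prod>i\<in>hits G w \<inter> {..<n}. s)"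
      by (rule prod.mono_neutral_cong_right) (auto simp: hits_def)
    then show ?thesis by simp
  qed
  have "(\<lambda>n. expectation (\<lambda>w. s ^ card (hits G w \<inter> {..<n}))) \<longlonglongrightarrow>
      expectation (\<lambda>w. if finite (hits G w) then s ^ card (hits G w) else 0)"
  proof (rule integral_dominated_convergence[where w="\<lambda>_. 1"])
    show "AE w in M. (\<lambda>n. s ^ card (hits G w \<inter> {..<n})) \<longlonglongrightarrow>
        (if finite (hits G w) then s ^ card (hits G w) else 0)"
      using power_card_tendsto[OF s] by auto
    show "AE w in M. norm (s ^ card (hits G w \<inter> {..<n})) \<le> 1" for n
      using s by (simp add: power_abs power_le_one)
  qed (use s in measurable)
  moreover have "(\<lambda>n. expectation (\<lambda>w. s ^ card (hits G w \<inter> {..<n}))) \<longlonglongrightarrow>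
      exp (- lam * (\<integral>y. (1 - s) * hit_prob G y \<partial>lborel))"
  proof -
    have "(1 - s) * hit_prob G y \<le> 1 * 1" for y
      using s hit_prob_bounds by (intro mult_mono) auto
    then have "(\<lambda>n. expectation (\<lambda>w. \<Prod>i<n. 1 - (1 - s) * hit_prob G (X w i))) \<longlonglongrightarrow>
        exp (- lam * (\<integral>y. (1 - s) * hit_prob G y \<partial>lborel))"
      using s int hit_prob_bounds by (intro expectation_prod_tendsto) auto
    then show ?thesis
      unfolding prod_eq[symmetric] using s by (simp add: expectation_marked_prod)
  qed
  ultimately show ?thesis
    using LIMSEQ_unique by fastforce
qed

text \<open>Both sides are the coefficients of the same power series in \<open>s\<close>. Finiteness
  is part of the event because an infinite set has \<open>card\<close> 0 and would be counted under
  \<open>k = 0\<close>.\<close>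

lemma prob_card_hits:
  assumes G [measurable]: "G \<in> sets (borel \<Otimes>\<^sub>M borel)"
    and int: "integrable lborel (hit_prob G)"
  defines "r \<equiv> lam * (\<integral>y. hit_prob G y \<partial>lborel)"
  shows "prob {w \<in> space M. finite (hits G w) \<and> card (hits G w) = k} = exp (- r) * r ^ k / fact k"
proof -
  define E where "E k = {w \<in> space M. finite (hits G w) \<and> card (hits G w) = k}" for k
  have [measurable]: "E k \<in> events" for k
    unfolding E_def by measurable
  have "prob (E k) = exp (- r) * r ^ k / fact k"
  proof (rule powser_coeffs_unique)
    fix s :: real assume s: "0 < s" "s < 1"
    have "(\<lambda>k. s ^ k * prob (E k)) sums expectation (\<lambda>w. if finite (hits G w) then s ^ card (hits G w) else 0)"
      by (rule expectation_disjoint_sums)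
         (use s in \<open>auto simp: E_def disjoint_family_on_def power_abs power_le_one\<close>)
    also have "expectation (\<lambda>w. if finite (hits G w) then s ^ card (hits G w) else 0) = exp (- r * (1 - s))"
      using s by (subst expectation_power_hits[OF G _ _ int]) (auto simp: r_def ac_simps)
    finally show "(\<lambda>k. prob (E k) * s ^ k) sums exp (- r * (1 - s))"
      by (simp add: mult.commute)
    have "(\<lambda>k. exp (- r) * ((r * s) ^ k / fact k)) sums (exp (- r) * exp (r * s))"
      by (intro sums_mult exp_sums_real)
    then show "(\<lambda>k. exp (- r) * r ^ k / fact k * s ^ k) sums exp (- r * (1 - s))"
      by (simp add: power_mult_distrib algebra_simps flip: exp_add)
  qed
  then show ?thesis by (simp add: E_def)
qed

end

subsection \<open>Order statistics\<close>

text \<open>The set \<open>A t\<close> changes only at values of \<open>z\<close>, so the infimum is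
  a minimum over such values. Since \<open>card\<close> vanishes on infinite sets, the condition
  \<open>n <= card (A t)\<close> with \<open>1 <= n\<close> forces \<open>A t\<close> to be finite,
  although larger thresholds may fail the condition.\<close>

lemma Inf_card_attained:
  fixes I :: "nat set" and z :: "nat \<Rightarrow> real" and n :: nat
  defines "A t \<equiv> {i \<in> I. z i \<le> t}"
  assumes n: "1 \<le> n" and t: "n \<le> card (A t)"
  obtains i where "i \<in> I" "Inf {t. n \<le> card (A t)} = z i" "n \<le> card (A (z i))"
    "\<And>s. n \<le> card (A s) \<Longrightarrow> z i \<le> s"
proof -
  \<comment> \<open>Lowering \<open>s\<close> to the largest value of \<open>z\<close> on
    \<open>A s\<close> does not change the set.\<close>
  have top: "\<exists>i\<in>A s. A (z i) = A s" if s: "n \<le> card (A s)" for s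
  proof -
    have fin: "finite (A s)" and ne: "A s \<noteq> {}"
      using s n by (auto intro: card_ge_0_finite)
    then have "Max (z ` A s) \<in> z ` A s" by simp
    then obtain i where i: "i \<in> A s" "z i = Max (z ` A s)" by force
    have "z j \<le> z i" if "j \<in> A s" for j
      unfolding i(2) using that fin by (intro Max_ge) auto
    moreover have "z i \<le> s" using i(1) by (simp add: A_def)
    ultimately have "A (z i) = A s"
      by (auto simp: A_def)
    with i(1) show ?thesis by blast
  qed
  \<comment> \<open>The finitely many candidates for the minimum below \<open>t\<close>; an
    admissible \<open>s\<close> above \<open>t\<close> exceeds all of them anyway.\<close>
  define W where "W = {i \<in> A t. n \<le> card (A (z i))}"
  have "finite (A t)" using t n by (auto intro: card_ge_0_finite)
  then have finW: "finite W" by (simp add: W_def)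
  have neW: "W \<noteq> {}" using top[OF t] t by (auto simp: W_def)
  have "Min (z ` W) \<in> z ` W" using finW neW by simp
  then obtain i where i: "i \<in> W" "z i = Min (z ` W)" by force
  have least: "z i \<le> s" if s: "n \<le> card (A s)" for s
  proof (cases "s \<le> t")
    case True
    obtain j where j: "j \<in> A s" "A (z j) = A s" using top[OF s] by auto
    then have "j \<in> W" using s True by (auto simp: W_def A_def)
    then have "z i \<le> z j" unfolding i(2) using finW by (intro Min_le) auto
    then show ?thesis using j by (auto simp: A_def)
  next
    case False
    then show ?thesis using i(1) by (auto simp: W_def A_def)
  qed
  show thesis
  proof
    show "i \<in> I" "n \<le> card (A (z i))" using i(1) by (auto simp: W_def A_def)
    then show "Inf {t. n \<le> card (A t)} = z i"
      by (intro cInf_eq_minimum) (auto simp: least)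
  qed (rule least)
qed

text \<open>Replaces the infimum over real thresholds by quantifiers over the countably many
  indices, which makes the event measurable. The second disjunct covers the case of no admissible
  threshold, where the infimum is the fixed value \<open>Inf {}\<close>.\<close>

lemma Inf_card_le_iff:
  fixes I :: "nat set" and z :: "nat \<Rightarrow> real" and n :: nat
  assumes n: "1 \<le> n"
  shows "Inf {t. n \<le> card {i \<in> I. z i \<le> t}} \<le> a \<longleftrightarrow>
    (\<exists>i\<in>I. n \<le> card {j \<in> I. z j \<le> z i} \<and> z i \<le> a) \<or>
    (\<forall>i\<in>I. \<not> n \<le> card {j \<in> I. z j \<le> z i}) \<and> Inf ({} :: real set) \<le> a"
proof (cases "\<exists>t. n \<le> card {i \<in> I. z i \<le> t}")
  case True
  then obtain t where "n \<le> card {i \<in> I. z i \<le> t}" by auto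
  then obtain i where i: "i \<in> I" "Inf {t. n \<le> card {i \<in> I. z i \<le> t}} = z i"
    "n \<le> card {j \<in> I. z j \<le> z i}" "\<And>s. n \<le> card {j \<in> I. z j \<le> s} \<Longrightarrow> z i \<le> s"
    using Inf_card_attained[OF n, where I=I and z=z and t=t] by blast
  then show ?thesis by (auto intro: order_trans)
qed auto

text \<open>With all the sets finite, \<open>card\<close> is monotone in the threshold, so every
  threshold above the attained minimum is admissible.\<close>

lemma Inf_card_le_iff_finite:
  fixes I :: "nat set" and z :: "nat \<Rightarrow> real" and n :: nat
  assumes n: "1 \<le> n" and fin: "\<And>t. finite {i \<in> I. z i \<le> t}"
    and ex: "n \<le> card {i \<in> I. z i \<le> t0}"
  shows "Inf {t. n \<le> card {i \<in> I. z i \<le> t}} \<le> a \<longleftrightarrow> n \<le> card {i \<in> I. z i \<le> a}"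
proof -
  obtain i where i: "i \<in> I" "Inf {t. n \<le> card {i \<in> I. z i \<le> t}} = z i"
    "n \<le> card {j \<in> I. z j \<le> z i}" "\<And>s. n \<le> card {j \<in> I. z j \<le> s} \<Longrightarrow> z i \<le> s"
    using Inf_card_attained[OF n ex] by blast
  have "n \<le> card {i \<in> I. z i \<le> a}" if "z i \<le> a"
    by (rule order_trans[OF i(3)]) (use that in \<open>auto intro!: card_mono fin\<close>)
  with i show ?thesis by auto
qed

subsection \<open>The density\<close>

text \<open>For \<open>c >= 0\<close>, the probability that a Poisson variable with mean
  \<open>c\<close> is less than \<open>n\<close>.\<close>

definition poisson_less :: "nat \<Rightarrow> real \<Rightarrow> real" where
  "poisson_less n c = (\<Sum>k<n. exp (- c) * c ^ k / fact k)"

text \<open>The derivative of each Poisson weight is a difference of neighbouring weights; the sum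
  telescopes and only the last weight survives.\<close>

lemma DERIV_poisson_less:
  "(poisson_less (Suc m) has_real_derivative - (exp (- c) * c ^ m / fact m)) (at c)"
proof (induction m)
  case 0
  show ?case
    unfolding poisson_less_def by (auto intro!: derivative_eq_intros)
next
  case (Suc m)
  have "((\<lambda>c. exp (- c) * c ^ Suc m / fact (Suc m)) has_real_derivative
      (exp (- c) * (real (Suc m) * c ^ m) - exp (- c) * c ^ Suc m) / fact (Suc m)) (at c)"
    by (rule derivative_eq_intros refl | simp)+
  moreover have "exp (- c) * (real (Suc m) * c ^ m) / fact (Suc m) = exp (- c) * c ^ m / fact m"
    by (simp add: fact_Suc del: of_nat_Suc)
  ultimately have "((\<lambda>c. exp (- c) * c ^ Suc m / fact (Suc m)) has_real_derivative
      exp (- c) * c ^ m / fact m - exp (- c) * c ^ Suc m / fact (Suc m)) (at c)"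
    by (simp only: diff_divide_distrib)
  from DERIV_add[OF Suc this] show ?case
    by (simp add: poisson_less_def[abs_def])
qed

lemma poisson_less_at_top: "(poisson_less n \<longlongrightarrow> 0) at_top"
proof -
  have "((\<lambda>c. \<Sum>k<n. (c ^ k / exp c) / fact k) \<longlongrightarrow> (\<Sum>k<n. 0 / fact k :: real)) at_top"
    by (intro tendsto_sum tendsto_divide[OF tendsto_power_div_exp_0 tendsto_const]) auto
  then show ?thesis
    by (simp add: poisson_less_def[abs_def] exp_minus field_simps)
qed

lemma poisson_less_0: "1 \<le> n \<Longrightarrow> poisson_less n 0 = 1"
  by (cases n) (simp_all add: poisson_less_def sum.lessThan_Suc_shift del: sum.lessThan_Suc)

lemma isCont_poisson_less: "isCont (poisson_less n) c"
  unfolding poisson_less_def[abs_def] by (intro continuous_intros) auto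

lemma filterlim_powr_at_top:
  fixes p :: real
  assumes p: "0 < p"
  shows "filterlim (\<lambda>z. z powr p) at_top at_top"
  unfolding filterlim_at_top
proof
  fix Z :: real
  show "eventually (\<lambda>z. Z \<le> z powr p) at_top"
    using eventually_ge_at_top[of "\<bar>Z\<bar> powr (1 / p)"]
  proof eventually_elim
    case (elim z)
    have "(\<bar>Z\<bar> powr (1 / p)) powr p \<le> z powr p"
      using p elim by (intro powr_mono2) auto
    then show ?case using p by (simp add: powr_powr)
  qed
qed

text \<open>A generalised gamma density: if \<open>Z\<close> has density \<open>f\<close>, then
  \<open>kap * Z powr p\<close> is gamma distributed with shape \<open>n\<close> and rate 1. The
  application takes \<open>p = 2 / alpha\<close>.\<close>

locale power_exponential_density =
  fixes kap p :: real and n :: nat and f :: "real \<Rightarrow> real"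
  assumes kap: "0 < kap" and p: "0 < p" and n: "1 \<le> n"
    and f: "\<And>z. f z = (if 0 < z then
      p * exp (- (kap * z powr p)) * (kap * z powr p) ^ n / (z * fact (n - 1)) else 0)"
begin

lemma f_measurable [measurable]: "f \<in> borel_measurable borel"
  unfolding f[abs_def] by measurable

lemma f_nonneg: "0 \<le> f z"
  using kap p by (simp add: f)

lemma DERIV_tail:
  assumes z: "0 < z"
  shows "((\<lambda>z. - poisson_less n (kap * z powr p)) has_real_derivative f z) (at z)"
proof -
  obtain m where m: "n = Suc m" using n by (cases n) auto
  let ?c = "kap * z powr p"
  have c: "((\<lambda>z. kap * z powr p) has_real_derivative p * ?c / z) (at z)"
    using z by (auto intro!: derivative_eq_intros simp: powr_diff)
  have "((\<lambda>z. - poisson_less n (kap * z powr p)) has_real_derivative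
      - (- (exp (- ?c) * ?c ^ m / fact m) * (p * ?c / z))) (at z)"
    unfolding m by (intro DERIV_minus DERIV_chain2[OF DERIV_poisson_less c])
  moreover have "- (- (exp (- ?c) * ?c ^ m / fact m) * (p * ?c / z)) = f z"
    using z by (simp add: f m ac_simps)
  ultimately show ?thesis by simp
qed

lemma kap_powr_at_top: "filterlim (\<lambda>z. kap * z powr p) at_top at_top"
  using kap p by (intro filterlim_tendsto_pos_mult_at_top[OF tendsto_const] filterlim_powr_at_top) auto

lemma emeasure_tail_pos:
  assumes t: "0 < t"
  shows "emeasure (density lborel f) {t<..} = ennreal (poisson_less n (kap * t powr p))"
proof -
  have "emeasure (density lborel f) {t<..} = (\<integral>\<^sup>+z. ennreal (f z) * indicator {t<..} z \<partial>lborel)"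
    by (subst emeasure_density) auto
  also have "\<dots> = (\<integral>\<^sup>+z. ennreal (f z) * indicator {t..} z \<partial>lborel)"
  proof (rule nn_integral_cong_AE)
    show "AE z in lborel. ennreal (f z) * indicator {t<..} z = ennreal (f z) * indicator {t..} z"
      using AE_lborel_singleton[of t] by eventually_elim (auto simp: indicator_def)
  qed
  also have "\<dots> = ennreal (0 - (- poisson_less n (kap * t powr p)))"
  proof (rule nn_integral_FTC_atLeast)
    show "((\<lambda>z. - poisson_less n (kap * z powr p)) \<longlongrightarrow> 0) at_top"
      using tendsto_minus[OF filterlim_compose[OF poisson_less_at_top kap_powr_at_top]] by simp
  qed (use t f_nonneg DERIV_tail in auto)
  finally show ?thesis by simp
qed

lemma emeasure_tail:
  "emeasure (density lborel f) {t<..} = ennreal (if 0 \<le> t then poisson_less n (kap * t powr p) else 1)"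
proof (cases "0 < t")
  case False
  have "emeasure (density lborel f) {t<..} = emeasure (density lborel f) {0<..}"
    using False by (simp add: emeasure_density) (intro nn_integral_cong, auto simp: f indicator_def)
  \<comment> \<open>Continuity from below along \<open>1 / (k + 1)\<close>: since
    \<open>0 powr p = 0\<close> and \<open>poisson_less n 0 = 1\<close>, the tails tend to 1. Thus
    \<open>f\<close> has total mass 1.\<close>
  also have "\<dots> = 1"
  proof (rule LIMSEQ_unique)
    have "(\<Union>k. {1 / real (Suc k)<..}) = {0::real<..}"
    proof (intro equalityI subsetI)
      fix z :: real assume "z \<in> {0<..}"
      then obtain k where "inverse (real (Suc k)) < z" using reals_Archimedean by auto
      then show "z \<in> (\<Union>k. {1 / real (Suc k)<..})" by (auto simp: inverse_eq_divide)
    next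
      fix z :: real assume "z \<in> (\<Union>k. {1 / real (Suc k)<..})"
      then obtain k where "1 / real (Suc k) < z" by auto
      moreover have "0 < 1 / real (Suc k)" by simp
      ultimately show "z \<in> {0<..}" by (simp only: greaterThan_iff)
    qed
    moreover have "incseq (\<lambda>k. {1 / real (Suc k)<..})"
      by (rule incseq_SucI) (auto simp: field_simps intro: le_less_trans[rotated])
    ultimately show "(\<lambda>k. emeasure (density lborel f) {1 / real (Suc k)<..}) \<longlonglongrightarrow> emeasure (density lborel f) {0<..}"
      using Lim_emeasure_incseq[of "\<lambda>k. {1 / real (Suc k)<..}" "density lborel f"]
      by (simp add: image_subset_iff)
    have "(\<lambda>k. kap * (1 / real (Suc k)) powr p) \<longlonglongrightarrow> kap * 0 powr p"
      by (intro tendsto_mult tendsto_const tendsto_powr' LIMSEQ_Suc[OF lim_1_over_n]) (use p in auto)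
    then have "(\<lambda>k. poisson_less n (kap * (1 / real (Suc k)) powr p)) \<longlonglongrightarrow> poisson_less n (kap * 0 powr p)"
      by (rule isCont_tendsto_compose[OF isCont_poisson_less])
    then have "(\<lambda>k. ennreal (poisson_less n (kap * (1 / real (Suc k)) powr p))) \<longlonglongrightarrow> ennreal 1"
      by (intro tendsto_ennrealI) (simp add: poisson_less_0[OF n])
    then show "(\<lambda>k. emeasure (density lborel f) {1 / real (Suc k)<..}) \<longlonglongrightarrow> 1"
      by (simp add: emeasure_tail_pos)
  qed
  finally show ?thesis
    using False by (auto simp: poisson_less_0[OF n])
qed (simp add: emeasure_tail_pos)

end

subsection \<open>Dominant interferers\<close>

locale interference = marked_poisson_process M lam X H "density lborel (\<lambda>t. ennreal (fh t))"
  for M :: "'w measure" and lam :: real and X :: "'w \<Rightarrow> nat \<Rightarrow> real^2"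
    and H :: "'w \<Rightarrow> nat \<Rightarrow> real" and fh :: "real \<Rightarrow> real" +
  fixes alpha phi hbar :: real and x :: "real^2"
  assumes lam_pos: "0 < lam" and alpha: "2 < alpha" and phi: "0 < phi" "phi \<le> 2 * pi"
    and fh_meas [measurable]: "fh \<in> borel_measurable borel"
    and fh_nonneg: "\<And>t. 0 \<le> fh t" and fh_supp: "\<And>t. t < 0 \<Longrightarrow> fh t = 0"
    and hbar: "has_bochner_integral lborel (\<lambda>h. indicator {0..} h * (h powr (2 / alpha) * fh h)) hbar"
begin

text \<open>If the moment were 0, \<open>fh\<close> would vanish almost everywhere, against its
  total mass 1. The single point 0, where the power vanishes, is set aside as a null set.\<close>

lemma hbar_pos: "0 < hbar"
proof -
  have nn: "0 \<le> indicator {0..} h * (h powr (2 / alpha) * fh h)" for h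
    using fh_nonneg[of h] by (auto simp: indicator_def)
  have hbar_eq: "hbar = (\<integral>h. indicator {0..} h * (h powr (2 / alpha) * fh h) \<partial>lborel)"
    and int: "integrable lborel (\<lambda>h. indicator {0..} h * (h powr (2 / alpha) * fh h))"
    using hbar by (auto simp: has_bochner_integral_iff)
  have "0 \<le> hbar" unfolding hbar_eq by (intro Bochner_Integration.integral_nonneg nn)
  moreover have "hbar \<noteq> 0"
  proof
    assume "hbar = 0"
    then have "AE h in lborel. indicator {0..} h * (h powr (2 / alpha) * fh h) = 0"
      using integral_nonneg_eq_0_iff_AE[OF int] nn unfolding hbar_eq by auto
    with AE_lborel_singleton[of 0] have "AE h in lborel. ennreal (fh h) = 0"
    proof eventually_elim
      case (elim h)
      then show ?case using fh_supp[of h] by (cases "h < 0") (auto simp: indicator_def)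
    qed
    then have "(\<integral>\<^sup>+h. ennreal (fh h) \<partial>lborel) = 0"
      by (subst nn_integral_0_iff_AE) auto
    then show False
      using prob_space.emeasure_space_1[OF prob_space_D] by (simp add: emeasure_density)
  qed
  ultimately show ?thesis by simp
qed

text \<open>Chosen so that \<open>card (N t)\<close> has mean
  \<open>kap * t powr (2 / alpha)\<close>.\<close>

definition kap :: real where "kap = hbar * phi * lam / 2"

lemma kap_pos: "0 < kap"
  using hbar_pos phi lam_pos by (simp add: kap_def)

text \<open>The condition \<open>0 < h\<close> is essential: with division by 0 giving 0, a point of
  zero gain would otherwise have value 0 and count as nearest.\<close>

definition near :: "real \<Rightarrow> ((real^2) \<times> real) set" where
  "near t = {(y, h). vec_angle (y - x) \<le> phi \<and> 0 < h \<and> norm (y - x) powr alpha / h \<le> t}"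

lemma near_sets [measurable]: "near t \<in> sets (borel \<Otimes>\<^sub>M borel)"
proof -
  have "Measurable.pred (borel \<Otimes>\<^sub>M borel)
      (\<lambda>(y :: real^2, h :: real). vec_angle (y - x) \<le> phi \<and> 0 < h \<and> norm (y - x) powr alpha / h \<le> t)"
    by measurable
  then show ?thesis
    by (simp add: near_def pred_def space_pair_measure)
qed

text \<open>For a fixed gain \<open>h > 0\<close> the bound on \<open>z\<close> says that the
  distance is at most \<open>(t * h) powr (1 / alpha)\<close>, so the section is a circular sector;
  squaring the radius produces the exponent \<open>2 / alpha\<close>. For \<open>h <= 0\<close> the
  section is empty.\<close>

lemma emeasure_near_section:
  assumes t: "0 \<le> t"
  shows "emeasure lborel {y. (y, h) \<in> near t} =
    ennreal (phi / 2 * t powr (2 / alpha) * (indicator {0<..} h * h powr (2 / alpha)))"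
proof (cases "0 < h")
  case True
  have "norm (y - x) powr alpha / h \<le> t \<longleftrightarrow> norm (y - x) \<le> (t * h) powr (1 / alpha)" for y
  proof -
    let ?a = "norm (y - x)" and ?b = "(t * h) powr (1 / alpha)"
    have b: "?b powr alpha = t * h"
      using alpha t True by (simp add: powr_powr)
    have "?a powr alpha \<le> ?b powr alpha \<longleftrightarrow> ?a \<le> ?b"
      using alpha powr_mono2[of alpha ?a ?b] powr_less_mono2[of alpha ?b ?a] by force
    then have "?a powr alpha \<le> t * h \<longleftrightarrow> ?a \<le> ?b"
      unfolding b .
    then show ?thesis using True by (simp add: pos_divide_le_eq)
  qed
  then have "{y. (y, h) \<in> near t} = {y. norm (y - x) \<le> (t * h) powr (1 / alpha) \<and> vec_angle (y - x) \<le> phi}"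
    using True by (auto simp: near_def)
  then have "emeasure lborel {y. (y, h) \<in> near t} = ennreal (phi / 2 * ((t * h) powr (1 / alpha))\<^sup>2)"
    by (simp only: emeasure_sector[OF powr_ge_zero phi])
  also have "((t * h) powr (1 / alpha))\<^sup>2 = t powr (2 / alpha) * h powr (2 / alpha)"
  proof -
    have "((t * h) powr (1 / alpha))\<^sup>2 = (t * h) powr (2 / alpha)"
      by (simp add: power2_eq_square flip: powr_add)
    then show ?thesis using t True by (simp add: powr_mult)
  qed
  finally show ?thesis using True by (simp add: mult.assoc)
qed (simp add: near_def)

text \<open>Measures \<open>near t\<close> in both orders: sections at fixed \<open>y\<close> give
  the hit probability, sections at fixed \<open>h\<close> the sector area, and averaging the latter
  against \<open>fh\<close> brings in the moment \<open>hbar\<close>.\<close>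

lemma hit_prob_near:
  assumes t: "0 \<le> t"
  shows "has_bochner_integral lborel (hit_prob (near t)) (phi / 2 * t powr (2 / alpha) * hbar)"
proof (rule has_bochner_integral_nn_integral)
  let ?D = "density lborel (\<lambda>t. ennreal (fh t))"
  interpret D: prob_space ?D by (rule prob_space_D)
  interpret LD: pair_sigma_finite "lborel :: (real^2) measure" ?D ..
  have near': "near t \<in> sets (lborel \<Otimes>\<^sub>M ?D)"
  proof -
    have "sets (lborel \<Otimes>\<^sub>M ?D) = sets ((borel :: (real^2) measure) \<Otimes>\<^sub>M (borel :: real measure))"
      by (intro sets_pair_measure_cong) auto
    then show ?thesis by simp
  qed
  have sect: "{h. (y, h) \<in> near t} = Pair y -` near t" "{y. (y, h) \<in> near t} = (\<lambda>y. (y, h)) -` near t" for y h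
    by auto
  have "(\<integral>\<^sup>+y. ennreal (hit_prob (near t) y) \<partial>lborel) = (\<integral>\<^sup>+y. emeasure ?D (Pair y -` near t) \<partial>lborel)"
    by (simp add: hit_prob_def D.emeasure_eq_measure sect)
  also have "\<dots> = emeasure (lborel \<Otimes>\<^sub>M ?D) (near t)"
    by (rule D.emeasure_pair_measure_alt[OF near', symmetric])
  also have "\<dots> = (\<integral>\<^sup>+h. emeasure lborel ((\<lambda>y. (y, h)) -` near t) \<partial>?D)"
    by (rule LD.emeasure_pair_measure_alt2[OF near'])
  also have "\<dots> = (\<integral>\<^sup>+h. ennreal (phi / 2 * t powr (2 / alpha) * (indicator {0<..} h * h powr (2 / alpha))) \<partial>?D)"
    by (simp only: emeasure_near_section[OF t] flip: sect(2))
  also have "\<dots> = (\<integral>\<^sup>+h. ennreal (fh h) *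
      ennreal (phi / 2 * t powr (2 / alpha) * (indicator {0<..} h * h powr (2 / alpha))) \<partial>lborel)"
    by (rule nn_integral_density) auto
  \<comment> \<open>Passing from \<open>{0<..}\<close> to \<open>{0..}\<close> changes nothing
    because \<open>0 powr (2 / alpha) = 0\<close>.\<close>
  also have "\<dots> = (\<integral>\<^sup>+h. ennreal (phi / 2 * t powr (2 / alpha) *
      (indicator {0..} h * (h powr (2 / alpha) * fh h))) \<partial>lborel)"
    using phi fh_nonneg
    by (intro nn_integral_cong) (auto simp: indicator_def ac_simps simp flip: ennreal_mult)
  also have "\<dots> = ennreal (phi / 2 * t powr (2 / alpha) * hbar)"
  proof -
    have "has_bochner_integral lborel (\<lambda>h. phi / 2 * t powr (2 / alpha) *
      (indicator {0..} h * (h powr (2 / alpha) * fh h))) (phi / 2 * t powr (2 / alpha) * hbar)"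
      by (intro has_bochner_integral_mult_right hbar)
    then show ?thesis
      using phi fh_nonneg
      by (subst nn_integral_eq_integral) (auto simp: has_bochner_integral_iff indicator_def)
  qed
  finally show "(\<integral>\<^sup>+y. ennreal (hit_prob (near t) y) \<partial>lborel) = ennreal (phi / 2 * t powr (2 / alpha) * hbar)" .
qed (use phi hbar_pos hit_prob_bounds in auto)

section \<open>The number of interferers up to a given threshold\<close>

abbreviation "N t w \<equiv> {i \<in> sector_idx x phi (X w) (H w). zval alpha x (X w) (H w) i \<le> t}"

lemma hits_near: "hits (near t) w = N t w"
  by (auto simp: hits_def near_def sector_idx_def zval_def)

lemma N_pred [measurable]: "Measurable.pred M (\<lambda>w. i \<in> N t w)"
  using hits_measurable[OF near_sets] by (simp only: hits_near)

lemma prob_card_N: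
  assumes "0 \<le> t"
  shows "prob {w \<in> space M. finite (N t w) \<and> card (N t w) = k} =
    exp (- (kap * t powr (2 / alpha))) * (kap * t powr (2 / alpha)) ^ k / fact k"
proof -
  note I = hit_prob_near[OF assms, unfolded has_bochner_integral_iff]
  have "lam * (\<integral>y. hit_prob (near t) y \<partial>lborel) = kap * t powr (2 / alpha)"
    using I by (simp add: kap_def)
  then show ?thesis
    using prob_card_hits[OF near_sets conjunct1[OF I], of k] by (simp add: hits_near)
qed

text \<open>The Poisson probabilities of the finite counts already sum to 1. Monotonicity in
  \<open>t\<close> reduces all thresholds to the countably many natural ones, giving a single null
  set.\<close>

lemma AE_finite_N: "AE w in M. \<forall>t. finite (N t w)"
proof -
  have "AE w in M. finite (N t w)" if t: "0 \<le> t" for t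
  proof -
    let ?c = "kap * t powr (2 / alpha)"
    have "(\<lambda>k. 1 * prob {w \<in> space M. finite (N t w) \<and> card (N t w) = k}) sums
        expectation (indicator {w \<in> space M. finite (N t w)})"
      by (rule expectation_disjoint_sums) (auto simp: disjoint_family_on_def indicator_def)
    moreover have "(\<lambda>k. 1 * prob {w \<in> space M. finite (N t w) \<and> card (N t w) = k}) sums (exp (- ?c) * exp ?c)"
      using sums_mult[OF exp_sums_real[of ?c], of "exp (- ?c)"] by (simp add: prob_card_N[OF t])
    ultimately have "expectation (indicator {w \<in> space M. finite (N t w)}) = exp (- ?c) * exp ?c"
      by (rule sums_unique2)
    then have "prob {w \<in> space M. finite (N t w)} = 1"
      by (simp flip: exp_add)
    then show ?thesis
      by (subst (asm) prob_eq_1) auto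
  qed
  then have "AE w in M. \<forall>m::nat. finite (N (real m) w)"
    by (simp add: AE_all_countable)
  then show ?thesis
  proof eventually_elim
    case (elim w)
    show ?case
    proof
      fix t :: real
      obtain m where "t \<le> real m" using real_arch_simple by blast
      then have "N t w \<subseteq> N (real m) w" by auto
      then show "finite (N t w)" using elim finite_subset by blast
    qed
  qed
qed

text \<open>An infinite \<open>N t w\<close> has \<open>card\<close> 0 and would also lie in the
  event, but that happens on a null set only.\<close>

lemma prob_card_N_less:
  assumes t: "0 \<le> t"
  shows "prob {w \<in> space M. \<not> n \<le> card (N t w)} = poisson_less n (kap * t powr (2 / alpha))"
proof -
  have "prob {w \<in> space M. \<not> n \<le> card (N t w)} =
      prob (\<Union>k\<in>{..<n}. {w \<in> space M. finite (N t w) \<and> card (N t w) = k})"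
    by (rule measure_eq_AE) (use AE_finite_N in \<open>auto elim!: eventually_mono\<close>)
  also have "\<dots> = (\<Sum>k<n. prob {w \<in> space M. finite (N t w) \<and> card (N t w) = k})"
    by (rule finite_measure_finite_Union) (auto simp: disjoint_family_on_def)
  finally show ?thesis
    by (simp add: prob_card_N[OF t] poisson_less_def)
qed

text \<open>Guarantees that the infimum in \<open>nth_z\<close> is over a nonempty set. The
  exceptional event lies in each event of fewer than \<open>n\<close> points up to threshold
  \<open>m\<close>, whose probability tends to 0 as the Poisson mean grows.\<close>

lemma AE_card_N_ge: "AE w in M. \<exists>t. n \<le> card (N t w)"
proof -
  define B where "B = {w \<in> space M. \<forall>m::nat. \<not> n \<le> card (N (real m) w)}"
  have [measurable]: "B \<in> events" unfolding B_def by measurable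
  have "prob B \<le> 0"
  proof (rule LIMSEQ_le_const)
    have "filterlim (\<lambda>m. kap * real m powr (2 / alpha)) at_top sequentially"
      using kap_pos alpha
      by (intro filterlim_tendsto_pos_mult_at_top[OF tendsto_const]
          filterlim_compose[OF filterlim_powr_at_top filterlim_real_sequentially]) auto
    from filterlim_compose[OF poisson_less_at_top this]
    show "(\<lambda>m. poisson_less n (kap * real m powr (2 / alpha))) \<longlonglongrightarrow> 0" .
    show "\<exists>K. \<forall>m\<ge>K. prob B \<le> poisson_less n (kap * real m powr (2 / alpha))"
    proof (intro exI allI impI)
      fix m :: nat
      show "prob B \<le> poisson_less n (kap * real m powr (2 / alpha))"
        by (subst prob_card_N_less[symmetric]) (auto simp: B_def intro!: finite_measure_mono)
    qed
  qed
  then have "prob B = 0" using measure_nonneg[of M B] by linarith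
  then have "AE w in M. w \<notin> B"
    by (subst (asm) prob_eq_0) auto
  with AE_space show ?thesis
    by eventually_elim (auto simp: B_def)
qed

section \<open>The law of the n-th smallest value\<close>

context
  fixes n :: nat
  assumes n: "1 \<le> n"
begin

text \<open>\<open>card\<close> of an infinite set is \<open>0\<close>, so the set whose infimum defines \<open>nth_z\<close> may be empty on a null
  set; measurability is needed there as well.\<close>

lemma nth_z_measurable [measurable]: "(\<lambda>w. nth_z alpha phi x (X w) (H w) n) \<in> borel_measurable M"
proof (rule borel_measurableI_le)
  fix a :: real
  have [measurable]: "Measurable.pred M (\<lambda>w. i \<in> sector_idx x phi (X w) (H w))" for i
    unfolding sector_idx_def by measurable
  have [measurable]: "(\<lambda>w. zval alpha x (X w) (H w) i) \<in> borel_measurable M" for i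
    unfolding zval_def by measurable
  show "{w \<in> space M. nth_z alpha phi x (X w) (H w) n \<le> a} \<in> events"
    unfolding nth_z_def Inf_card_le_iff[OF n] Bex_def Ball_def by measurable
qed

lemma AE_nth_z_le_iff: "AE w in M. nth_z alpha phi x (X w) (H w) n \<le> t \<longleftrightarrow> n \<le> card (N t w)"
  using AE_finite_N AE_card_N_ge[of n]
proof eventually_elim
  case (elim w)
  then show ?case
    unfolding nth_z_def using Inf_card_le_iff_finite[OF n] by blast
qed

lemma prob_nth_z_greater:
  "prob {w \<in> space M. t < nth_z alpha phi x (X w) (H w) n} =
    (if 0 \<le> t then poisson_less n (kap * t powr (2 / alpha)) else 1)"
proof -
  have eq: "prob {w \<in> space M. t < nth_z alpha phi x (X w) (H w) n} = prob {w \<in> space M. \<not> n \<le> card (N t w)}"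
    by (rule measure_eq_AE) (use AE_nth_z_le_iff[of t] in \<open>auto elim!: eventually_mono\<close>)
  show ?thesis
  proof (cases "0 \<le> t")
    case False
    have N_empty: "N t w = {}" for w
    proof -
      have "0 \<le> zval alpha x (X w) (H w) i" if "i \<in> sector_idx x phi (X w) (H w)" for i
        using that by (simp add: zval_def sector_idx_def)
      then show ?thesis using False by force
    qed
    show ?thesis using False n by (simp only: eq N_empty) (simp add: prob_space)
  qed (simp add: eq prob_card_N_less)
qed

text \<open>Both measures have the same finite mass on every half-line \<open>{t<..}\<close>, and
  these masses determine a Borel measure on the reals.\<close>

lemma distributed_nth_z:
  assumes f: "\<And>z. f z = (if 0 < z then 2 / alpha * exp (- (kap * z powr (2 / alpha))) *
      (kap * z powr (2 / alpha)) ^ n / (z * fact (n - 1)) else 0)"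
  shows "distributed M lborel (\<lambda>w. nth_z alpha phi x (X w) (H w) n) (\<lambda>z. ennreal (f z))"
proof -
  interpret power_exponential_density kap "2 / alpha" n f
    using kap_pos alpha n f by unfold_locales auto
  have "distr M lborel (\<lambda>w. nth_z alpha phi x (X w) (H w) n) = density lborel (\<lambda>z. ennreal (f z))"
  proof (rule measure_eqI_lessThan)
    fix t :: real
    have "emeasure (distr M lborel (\<lambda>w. nth_z alpha phi x (X w) (H w) n)) {t<..} =
        ennreal (prob {w \<in> space M. t < nth_z alpha phi x (X w) (H w) n})"
      by (subst emeasure_distr) (auto simp: emeasure_eq_measure vimage_def Int_def conj_commute)
    then show "emeasure (distr M lborel (\<lambda>w. nth_z alpha phi x (X w) (H w) n)) {t<..} < \<infinity>"
      and "emeasure (distr M lborel (\<lambda>w. nth_z alpha phi x (X w) (H w) n)) {t<..} =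
        emeasure (density lborel (\<lambda>z. ennreal (f z))) {t<..}"
      by (simp_all add: prob_nth_z_greater emeasure_tail)
  qed auto
  then show ?thesis
    by (simp add: distributed_def)
qed

end

end

theorem theorem1:
  fixes M :: "'w measure"
    and X :: "'w \<Rightarrow> nat \<Rightarrow> real^2"
    and H :: "'w \<Rightarrow> nat \<Rightarrow> real"
    and fh :: "real \<Rightarrow> real"
    and lam alpha phi :: real
    and x :: "real^2"
    and n :: nat
  assumes lam_pos: "lam > 0"
    and alpha: "alpha > 2"
    and phi: "0 < phi" "phi \<le> 2 * pi"
    and PPP: "poisson_pp M lam X"
    and fh_meas: "fh \<in> borel_measurable borel"
    and fh_nonneg: "\<And>t. fh t \<ge> 0"
    and fh_supp: "\<And>t. t < 0 \<Longrightarrow> fh t = 0"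
    and H_dist: "\<And>i. distributed M lborel (\<lambda>w. H w i) (\<lambda>t. ennreal (fh t))"
    and H_indep: "prob_space.indep_vars M (\<lambda>_. borel) (\<lambda>i w. H w i) UNIV"
    and H_X_indep: "prob_space.indep_set M
                      (sets (vimage_algebra (space M) X (Pi\<^sub>M UNIV (\<lambda>_. borel))))
                      (sets (vimage_algebra (space M) H (Pi\<^sub>M UNIV (\<lambda>_. borel))))"
    and hbar_fin: "integrable lborel (\<lambda>h. indicator {0..} h * (h powr (2 / alpha) * fh h))"
    and n: "n \<ge> 1"
  shows "distributed M lborel (\<lambda>w. nth_z alpha phi x (X w) (H w) n)
           (\<lambda>z. ennreal (if z > 0 then
              (let hbar = (\<integral>h\<in>{0..}. h powr (2 / alpha) * fh h \<partial>lborel);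
                   c = (1/2) * hbar * phi * lam * z powr (2 / alpha)
               in 2 * exp (- c) * c ^ n / (alpha * z * fact (n - 1)))
            else 0))"
proof -
  define hbar where "hbar = (\<integral>h\<in>{0..}. h powr (2 / alpha) * fh h \<partial>lborel)"
  interpret prob_space M
    using PPP by (simp add: poisson_pp_def)
  \<comment> \<open>The hypothesis is phrased over \<open>lborel\<close>, the locale over
    \<open>borel\<close>; both have the same measurable sets, so the laws coincide.\<close>
  have D: "distr M borel (\<lambda>w. H w i) = density lborel (\<lambda>t. ennreal (fh t))" for i
  proof -
    have "distr M borel (\<lambda>w. H w i) = distr M lborel (\<lambda>w. H w i)"
      by (rule distr_cong) auto
    then show ?thesis
      using distributed_distr_eq_density[OF H_dist] by simp
  qed
  interpret interference M lam X H fh alpha phi hbar x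
    by unfold_locales
      (use assms D in \<open>auto simp: hbar_def set_lebesgue_integral_def has_bochner_integral_iff\<close>)
  show ?thesis
    unfolding hbar_def[symmetric]
    by (rule distributed_nth_z[OF n]) (simp add: kap_def Let_def ac_simps)
qed

end
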